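(* Let $G$ be an eight-dimensional Lie group equipped with a left-invariant Riemannian metric and containing the subgroup $K=\mathbf{SU}(2)\times\mathbf{SU}(2)$, equipped with its standard Riemannian metric. Let $\mathcal{V}$ be the left-invariant distribution on $G$ generated by the Lie algebra $\mathfrak{k}=\mathfrak{su}(2)\times\mathfrak{su}(2)$. Then the resulting foliation $\mathcal{F}$ tangent to $\mathcal{V}$ is Riemannian and totally geodesic.
   Context: The left-invariant metric $g$ on $G$ restricts to the standard metric on $K$ induced by the Killing form: $\mathfrak{k}$ has a basis $\{A,B,C,R,S,T\}$, orthonormal with respect to $g$, such that $\{A,B,C\}$ and $\{R,S,T\}$ span the two commuting copies of $\mathfrak{su}(2)$ and $[A,B]=2C$, $[C,A]=2B$, $[B,C]=2A$, $[R,S]=2T$, $[T,R]=2S$, $[S,T]=2R$. Let $\mathcal{H}$ be the orthogonal complement distribution of $\mathcal{V}$; the symbols $\mathcal{V},\mathcal{H}$ also denote the orthogonal projections, and $\nabla$ is the Levi-Civita connection. The second fundamental forms are $B^{\mathcal{V}}(E,F)=\tfrac12\mathcal{H}(\nabla_EF+\nabla_FE)$ for $E,F\in\mathcal{V}$ and $B^{\mathcal{H}}(X,Y)=\tfrac12\mathcal{V}(\nabla_XY+\nabla_YX)$ for $X,Y\in\mathcal{H}$. $\mathcal{F}$ is Riemannian if $B^{\mathcal{H}}=0$ and totally geodesic if $B^{\mathcal{V}}=0$. *)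

theory Defs
  imports "HOL-Analysis.Analysis" "HOL-Algebra.Group"
begin

section \<open>Smooth manifolds\<close>

text \<open>Smoothness of maps between Euclidean spaces; only meant for open domains.\<close>

primrec Ck_on :: "nat \<Rightarrow> 'a::euclidean_space set \<Rightarrow> ('a \<Rightarrow> 'b::real_normed_vector) \<Rightarrow> bool" where
  "Ck_on 0 S f \<longleftrightarrow> continuous_on S f"
| "Ck_on (Suc k) S f \<longleftrightarrow>
     (\<forall>x\<in>S. f differentiable (at x)) \<and>
     (\<forall>v. Ck_on k S (\<lambda>x. frechet_derivative f (at x) v))"

definition smooth_on :: "'a::euclidean_space set \<Rightarrow> ('a \<Rightarrow> 'b::real_normed_vector) \<Rightarrow> bool" where
  "smooth_on S f \<longleftrightarrow> (\<forall>k. Ck_on k S f)"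

text \<open>A manifold is a whole type \<open>'g\<close> (Hausdorff and second countable, by its sort) with a smooth
  atlas, not necessarily maximal. A chart is a pair of its domain and a total function that matters
  only on the domain; the dimension is that of the model space \<open>'e\<close>.\<close>

type_synonym ('g, 'e) chart = "'g set \<times> ('g \<Rightarrow> 'e)"

definition is_chart :: "('g::topological_space, 'e::euclidean_space) chart \<Rightarrow> bool" where
  "is_chart = (\<lambda>(U, \<phi>). open U \<and> open (\<phi> ` U) \<and> homeomorphism U (\<phi> ` U) \<phi> (inv_into U \<phi>))"

definition smooth_atlas :: "('g::topological_space, 'e::euclidean_space) chart set \<Rightarrow> bool" where
  "smooth_atlas \<A> \<longleftrightarrow>
     (\<forall>c\<in>\<A>. is_chart c) \<and> (\<Union>c\<in>\<A>. fst c) = UNIV \<and>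
     (\<forall>(U, \<phi>)\<in>\<A>. \<forall>(V, \<psi>)\<in>\<A>. smooth_on (\<phi> ` (U \<inter> V)) (\<lambda>x. \<psi> (inv_into U \<phi> x)))"

definition smooth_fun_on ::
    "('g::topological_space, 'e::euclidean_space) chart set \<Rightarrow> 'g set \<Rightarrow> ('g \<Rightarrow> real) \<Rightarrow> bool" where
  "smooth_fun_on \<A> W f \<longleftrightarrow> (\<forall>(U, \<phi>)\<in>\<A>. smooth_on (\<phi> ` (U \<inter> W)) (\<lambda>x. f (inv_into U \<phi> x)))"

definition smooth_near ::
    "('g::topological_space, 'e::euclidean_space) chart set \<Rightarrow> 'g \<Rightarrow> ('g \<Rightarrow> real) \<Rightarrow> bool" where
  "smooth_near \<A> p f \<longleftrightarrow> (\<exists>W. open W \<and> p \<in> W \<and> smooth_fun_on \<A> W f)"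

text \<open>Tangent vectors at \<open>p\<close> are the derivations of the algebra of germs at \<open>p\<close> of smooth functions.
  Germs are represented by total functions smooth near \<open>p\<close>; on all other functions a tangent vector
  takes the value 0, so that equality of tangent vectors is equality of functions.\<close>

type_synonym 'g tvec = "('g \<Rightarrow> real) \<Rightarrow> real"
type_synonym 'g vfield = "'g \<Rightarrow> 'g tvec"

definition tangent_space ::
    "('g::topological_space, 'e::euclidean_space) chart set \<Rightarrow> 'g \<Rightarrow> 'g tvec set" where
  "tangent_space \<A> p = {v.
     (\<forall>f. \<not> smooth_near \<A> p f \<longrightarrow> v f = 0) \<and>
     (\<forall>f h. smooth_near \<A> p f \<and> (\<exists>W. open W \<and> p \<in> W \<and> (\<forall>q\<in>W. f q = h q)) \<longrightarrow> v f = v h) \<and>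
     (\<forall>f h a b. smooth_near \<A> p f \<and> smooth_near \<A> p h \<longrightarrow>
        v (\<lambda>q. a * f q + b * h q) = a * v f + b * v h) \<and>
     (\<forall>f h. smooth_near \<A> p f \<and> smooth_near \<A> p h \<longrightarrow>
        v (\<lambda>q. f q * h q) = v f * h p + f p * v h)}"

definition smooth_vector_field ::
    "('g::topological_space, 'e::euclidean_space) chart set \<Rightarrow> 'g vfield \<Rightarrow> bool" where
  "smooth_vector_field \<A> X \<longleftrightarrow>
     (\<forall>p. X p \<in> tangent_space \<A> p) \<and>
     (\<forall>W f. open W \<and> smooth_fun_on \<A> W f \<longrightarrow> smooth_fun_on \<A> W (\<lambda>p. X p f))"

text \<open>The guard keeps the convention above: \<open>\<lambda>q. Y q f\<close> can be smooth near \<open>p\<close> although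
  \<open>f\<close> is not.\<close>

definition lie_bracket ::
    "('g::topological_space, 'e::euclidean_space) chart set \<Rightarrow> 'g vfield \<Rightarrow> 'g vfield \<Rightarrow> 'g vfield" where
  "lie_bracket \<A> X Y = (\<lambda>p f.
     if smooth_near \<A> p f then X p (\<lambda>q. Y q f) - Y p (\<lambda>q. X q f) else 0)"

definition vf_span :: "'g vfield list \<Rightarrow> 'g vfield set" where
  "vf_span Xs = {(\<lambda>p f. \<Sum>i<length Xs. c i * (Xs ! i) p f) | c :: nat \<Rightarrow> real. True}"

definition integral_curve ::
    "('g::topological_space, 'e::euclidean_space) chart set \<Rightarrow> 'g vfield \<Rightarrow> (real \<Rightarrow> 'g) \<Rightarrow> bool" where
  "integral_curve \<A> X \<gamma> \<longleftrightarrow> continuous_on UNIV \<gamma> \<and>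
     (\<forall>t f. smooth_near \<A> (\<gamma> t) f \<longrightarrow>
        ((\<lambda>s. f (\<gamma> s)) has_real_derivative X (\<gamma> t) f) (at t))"


section \<open>Riemannian metrics and the Levi-Civita connection\<close>

type_synonym 'g metric = "'g \<Rightarrow> 'g tvec \<Rightarrow> 'g tvec \<Rightarrow> real"

definition riemannian_metric ::
    "('g::topological_space, 'e::euclidean_space) chart set \<Rightarrow> 'g metric \<Rightarrow> bool" where
  "riemannian_metric \<A> g \<longleftrightarrow>
     (\<forall>p. \<forall>u\<in>tangent_space \<A> p. \<forall>v\<in>tangent_space \<A> p. \<forall>w\<in>tangent_space \<A> p. \<forall>a b.
        g p (\<lambda>f. a * u f + b * v f) w = a * g p u w + b * g p v w) \<and>
     (\<forall>p. \<forall>u\<in>tangent_space \<A> p. \<forall>v\<in>tangent_space \<A> p. g p u v = g p v u) \<and>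
     (\<forall>p. \<forall>u\<in>tangent_space \<A> p. u \<noteq> (\<lambda>f. 0) \<longrightarrow> g p u u > 0) \<and>
     (\<forall>X Y. smooth_vector_field \<A> X \<and> smooth_vector_field \<A> Y \<longrightarrow>
        smooth_fun_on \<A> UNIV (\<lambda>p. g p (X p) (Y p)))"

definition affine_connection ::
    "('g::topological_space, 'e::euclidean_space) chart set \<Rightarrow>
     ('g vfield \<Rightarrow> 'g vfield \<Rightarrow> 'g vfield) \<Rightarrow> bool" where
  "affine_connection \<A> D \<longleftrightarrow>
     (\<forall>X Y. smooth_vector_field \<A> X \<and> smooth_vector_field \<A> Y \<longrightarrow> smooth_vector_field \<A> (D X Y)) \<and>
     (\<forall>X Y Z a b. smooth_vector_field \<A> X \<and> smooth_vector_field \<A> Y \<and> smooth_vector_field \<A> Z \<and>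
        smooth_fun_on \<A> UNIV a \<and> smooth_fun_on \<A> UNIV b \<longrightarrow>
        D (\<lambda>p f. a p * X p f + b p * Y p f) Z = (\<lambda>p f. a p * D X Z p f + b p * D Y Z p f)) \<and>
     (\<forall>X Y Z. smooth_vector_field \<A> X \<and> smooth_vector_field \<A> Y \<and> smooth_vector_field \<A> Z \<longrightarrow>
        D X (\<lambda>p f. Y p f + Z p f) = (\<lambda>p f. D X Y p f + D X Z p f)) \<and>
     (\<forall>X Y a. smooth_vector_field \<A> X \<and> smooth_vector_field \<A> Y \<and> smooth_fun_on \<A> UNIV a \<longrightarrow>
        D X (\<lambda>p f. a p * Y p f) = (\<lambda>p f. X p a * Y p f + a p * D X Y p f))"

definition levi_civita ::
    "('g::topological_space, 'e::euclidean_space) chart set \<Rightarrow> 'g metric \<Rightarrow>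
     ('g vfield \<Rightarrow> 'g vfield \<Rightarrow> 'g vfield) \<Rightarrow> bool" where
  "levi_civita \<A> g D \<longleftrightarrow> affine_connection \<A> D \<and>
     (\<forall>X Y. smooth_vector_field \<A> X \<and> smooth_vector_field \<A> Y \<longrightarrow>
        (\<lambda>p f. D X Y p f - D Y X p f) = lie_bracket \<A> X Y) \<and>
     (\<forall>X Y Z. smooth_vector_field \<A> X \<and> smooth_vector_field \<A> Y \<and> smooth_vector_field \<A> Z \<longrightarrow>
        (\<forall>p. X p (\<lambda>q. g q (Y q) (Z q)) = g p (D X Y p) (Z p) + g p (Y p) (D X Z p)))"


section \<open>Distributions and foliations\<close>

type_synonym 'g distribution = "'g \<Rightarrow> 'g tvec set"

definition sections ::
    "('g::topological_space, 'e::euclidean_space) chart set \<Rightarrow> 'g distribution \<Rightarrow> 'g vfield set" where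
  "sections \<A> V = {X. smooth_vector_field \<A> X \<and> (\<forall>p. X p \<in> V p)}"

definition smooth_distribution ::
    "('g::topological_space, 'e::euclidean_space) chart set \<Rightarrow> nat \<Rightarrow> 'g distribution \<Rightarrow> bool" where
  "smooth_distribution \<A> r V \<longleftrightarrow>
     (\<forall>p. \<exists>W Xs. open W \<and> p \<in> W \<and> length Xs = r \<and> (\<forall>X\<in>set Xs. smooth_vector_field \<A> X) \<and>
        (\<forall>q\<in>W. V q = (\<lambda>X. X q) ` vf_span Xs \<and>
           (\<forall>c::nat \<Rightarrow> real. (\<lambda>f. \<Sum>i<r. c i * (Xs ! i) q f) = (\<lambda>f. 0) \<longrightarrow> (\<forall>i<r. c i = 0))))"

text \<open>A foliation with leaves of dimension \<open>r\<close> is given, via the Frobenius theorem, by its tangent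
  distribution.\<close>

definition foliation ::
    "('g::topological_space, 'e::euclidean_space) chart set \<Rightarrow> nat \<Rightarrow> 'g distribution \<Rightarrow> bool" where
  "foliation \<A> r V \<longleftrightarrow> smooth_distribution \<A> r V \<and>
     (\<forall>E\<in>sections \<A> V. \<forall>F\<in>sections \<A> V. lie_bracket \<A> E F \<in> sections \<A> V)"

definition orth_complement ::
    "('g::topological_space, 'e::euclidean_space) chart set \<Rightarrow> 'g metric \<Rightarrow>
     'g distribution \<Rightarrow> 'g distribution" where
  "orth_complement \<A> g V = (\<lambda>p. {v \<in> tangent_space \<A> p. \<forall>u\<in>V p. g p v u = 0})"

definition orth_projection :: "'g metric \<Rightarrow> 'g distribution \<Rightarrow> 'g vfield \<Rightarrow> 'g vfield" where
  "orth_projection g V X = (\<lambda>p.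
     THE w. w \<in> V p \<and> (\<forall>u\<in>V p. g p (\<lambda>f. X p f - w f) u = 0))"

definition second_fundamental_form ::
    "('g::topological_space, 'e::euclidean_space) chart set \<Rightarrow> 'g metric \<Rightarrow>
     ('g vfield \<Rightarrow> 'g vfield \<Rightarrow> 'g vfield) \<Rightarrow> 'g distribution \<Rightarrow> 'g vfield \<Rightarrow> 'g vfield \<Rightarrow> 'g vfield" where
  "second_fundamental_form \<A> g D V E F = (\<lambda>p f.
     1 / 2 * orth_projection g (orth_complement \<A> g V) (\<lambda>q h. D E F q h + D F E q h) p f)"

text \<open>The second fundamental form of the horizontal distribution projects onto the vertical
  distribution itself, not onto its double orthogonal complement.\<close>

definition horizontal_second_fundamental_form ::
    "'g metric \<Rightarrow> ('g vfield \<Rightarrow> 'g vfield \<Rightarrow> 'g vfield) \<Rightarrow> 'g distribution \<Rightarrow>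
     'g vfield \<Rightarrow> 'g vfield \<Rightarrow> 'g vfield" where
  "horizontal_second_fundamental_form g D V X Y = (\<lambda>p f.
     1 / 2 * orth_projection g V (\<lambda>q h. D X Y q h + D Y X q h) p f)"

definition totally_geodesic ::
    "('g::topological_space, 'e::euclidean_space) chart set \<Rightarrow> 'g metric \<Rightarrow>
     ('g vfield \<Rightarrow> 'g vfield \<Rightarrow> 'g vfield) \<Rightarrow> 'g distribution \<Rightarrow> bool" where
  "totally_geodesic \<A> g D V \<longleftrightarrow>
     (\<forall>E\<in>sections \<A> V. \<forall>F\<in>sections \<A> V. second_fundamental_form \<A> g D V E F = (\<lambda>p f. 0))"

definition riemannian_foliation ::
    "('g::topological_space, 'e::euclidean_space) chart set \<Rightarrow> 'g metric \<Rightarrow>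
     ('g vfield \<Rightarrow> 'g vfield \<Rightarrow> 'g vfield) \<Rightarrow> 'g distribution \<Rightarrow> bool" where
  "riemannian_foliation \<A> g D V \<longleftrightarrow>
     (\<forall>X\<in>sections \<A> (orth_complement \<A> g V). \<forall>Y\<in>sections \<A> (orth_complement \<A> g V).
        horizontal_second_fundamental_form g D V X Y = (\<lambda>p f. 0))"


section \<open>Lie groups\<close>

definition lie_group ::
    "'g::{t2_space, second_countable_topology} monoid \<Rightarrow> ('g, 'e::euclidean_space) chart set \<Rightarrow> bool" where
  "lie_group G \<A> \<longleftrightarrow> group G \<and> carrier G = UNIV \<and> smooth_atlas \<A> \<and>
     continuous_on UNIV (\<lambda>(x, y). x \<otimes>\<^bsub>G\<^esub> y) \<and>
     continuous_on UNIV (\<lambda>x. inv\<^bsub>G\<^esub> x) \<and>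
     (\<forall>(U, \<phi>)\<in>\<A>. \<forall>(V, \<psi>)\<in>\<A>. \<forall>(W, \<xi>)\<in>\<A>.
        smooth_on {(x, y). x \<in> \<phi> ` U \<and> y \<in> \<psi> ` V \<and> inv_into U \<phi> x \<otimes>\<^bsub>G\<^esub> inv_into V \<psi> y \<in> W}
          (\<lambda>(x, y). \<xi> (inv_into U \<phi> x \<otimes>\<^bsub>G\<^esub> inv_into V \<psi> y))) \<and>
     (\<forall>(U, \<phi>)\<in>\<A>. \<forall>(V, \<psi>)\<in>\<A>.
        smooth_on {x \<in> \<phi> ` U. inv\<^bsub>G\<^esub> (inv_into U \<phi> x) \<in> V} (\<lambda>x. \<psi> (inv\<^bsub>G\<^esub> (inv_into U \<phi> x))))"

definition push_left :: "'g monoid \<Rightarrow> 'g \<Rightarrow> 'g tvec \<Rightarrow> 'g tvec" where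
  "push_left G a v = (\<lambda>f. v (\<lambda>q. f (a \<otimes>\<^bsub>G\<^esub> q)))"

definition left_invariant_fields ::
    "'g::topological_space monoid \<Rightarrow> ('g, 'e::euclidean_space) chart set \<Rightarrow> 'g vfield set" where
  "left_invariant_fields G \<A> =
     {X. smooth_vector_field \<A> X \<and> (\<forall>a p. X (a \<otimes>\<^bsub>G\<^esub> p) = push_left G a (X p))}"

definition left_invariant_metric ::
    "'g::topological_space monoid \<Rightarrow> ('g, 'e::euclidean_space) chart set \<Rightarrow> 'g metric \<Rightarrow> bool" where
  "left_invariant_metric G \<A> g \<longleftrightarrow>
     (\<forall>a p. \<forall>u\<in>tangent_space \<A> p. \<forall>v\<in>tangent_space \<A> p.
        g (a \<otimes>\<^bsub>G\<^esub> p) (push_left G a u) (push_left G a v) = g p u v)"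

text \<open>The Lie algebra of a closed subgroup, as the left-invariant fields whose one-parameter subgroup
  stays in the subgroup.\<close>

definition subgroup_lie_algebra ::
    "'g::topological_space monoid \<Rightarrow> ('g, 'e::euclidean_space) chart set \<Rightarrow> 'g set \<Rightarrow> 'g vfield set" where
  "subgroup_lie_algebra G \<A> K = {X \<in> left_invariant_fields G \<A>.
     \<exists>\<gamma>. integral_curve \<A> X \<gamma> \<and> \<gamma> 0 = \<one>\<^bsub>G\<^esub> \<and> (\<forall>t. \<gamma> t \<in> K)}"

text \<open>The Lie algebra passed here is already a linear space, so no linear span is taken.\<close>

definition generated_distribution :: "'g vfield set \<Rightarrow> 'g distribution" where
  "generated_distribution \<kk> = (\<lambda>p. (\<lambda>X. X p) ` \<kk>)"


section \<open>The subgroup SU(2) x SU(2) and its standard metric\<close>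

definition SU2 :: "(complex^2^2) monoid" where
  "SU2 = \<lparr>carrier = {U. U ** (\<chi> i j. cnj (U $ j $ i)) = mat 1 \<and> det U = 1},
          mult = (**), one = mat 1\<rparr>"

text \<open>Smoothness of a map on an embedded submanifold \<open>S\<close> of a Euclidean space, by local smooth
  extension.\<close>

definition smooth_map_from ::
    "'a::euclidean_space set \<Rightarrow> ('g::topological_space, 'e::euclidean_space) chart set \<Rightarrow>
     ('a \<Rightarrow> 'g) \<Rightarrow> bool" where
  "smooth_map_from S \<A> \<iota> \<longleftrightarrow> continuous_on S \<iota> \<and>
     (\<forall>(U, \<phi>)\<in>\<A>. \<forall>x\<in>S. \<iota> x \<in> U \<longrightarrow>
        (\<exists>W F. open W \<and> x \<in> W \<and> smooth_on W F \<and> (\<forall>y\<in>S \<inter> W. \<iota> y \<in> U \<and> F y = \<phi> (\<iota> y))))"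

text \<open>An injective smooth homomorphism of Lie groups is an immersion, and here its domain is compact,
  so the image is a closed embedded Lie subgroup isomorphic to SU(2) x SU(2).\<close>

definition SU2xSU2_embedding ::
    "'g::topological_space monoid \<Rightarrow> ('g, 'e::euclidean_space) chart set \<Rightarrow>
     ((complex^2^2) \<times> (complex^2^2) \<Rightarrow> 'g) \<Rightarrow> bool" where
  "SU2xSU2_embedding G \<A> \<iota> \<longleftrightarrow>
     \<iota> \<in> hom (SU2 \<times>\<times> SU2) G \<and> inj_on \<iota> (carrier (SU2 \<times>\<times> SU2)) \<and>
     smooth_map_from (carrier (SU2 \<times>\<times> SU2)) \<A> \<iota>"

definition su2_relations ::
    "('g::topological_space, 'e::euclidean_space) chart set \<Rightarrow>
     'g vfield \<Rightarrow> 'g vfield \<Rightarrow> 'g vfield \<Rightarrow> bool" where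
  "su2_relations \<A> X Y Z \<longleftrightarrow>
     lie_bracket \<A> X Y = (\<lambda>p f. 2 * Z p f) \<and>
     lie_bracket \<A> Z X = (\<lambda>p f. 2 * Y p f) \<and>
     lie_bracket \<A> Y Z = (\<lambda>p f. 2 * X p f)"

definition orthonormal_frame :: "'g metric \<Rightarrow> 'g vfield list \<Rightarrow> bool" where
  "orthonormal_frame g Xs \<longleftrightarrow>
     (\<forall>p. \<forall>i<length Xs. \<forall>j<length Xs. g p ((Xs ! i) p) ((Xs ! j) p) = (if i = j then 1 else 0))"

text \<open>The metric restricts to the standard metric of SU(2) x SU(2), that is (by the bracket relations)
  to -1/8 times the Killing form of its Lie algebra.\<close>

definition standard_on_SU2xSU2 ::
    "'g::topological_space monoid \<Rightarrow> ('g, 'e::euclidean_space) chart set \<Rightarrow> 'g metric \<Rightarrow>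
     ((complex^2^2) \<times> (complex^2^2) \<Rightarrow> 'g) \<Rightarrow> bool" where
  "standard_on_SU2xSU2 G \<A> g \<iota> \<longleftrightarrow>
     (\<exists>A B C R S T.
        vf_span [A, B, C, R, S, T] = subgroup_lie_algebra G \<A> (\<iota> ` carrier (SU2 \<times>\<times> SU2)) \<and>
        vf_span [A, B, C] = subgroup_lie_algebra G \<A> (\<iota> ` (carrier SU2 \<times> {\<one>\<^bsub>SU2\<^esub>})) \<and>
        vf_span [R, S, T] = subgroup_lie_algebra G \<A> (\<iota> ` ({\<one>\<^bsub>SU2\<^esub>} \<times> carrier SU2)) \<and>
        orthonormal_frame g [A, B, C, R, S, T] \<and>
        su2_relations \<A> A B C \<and> su2_relations \<A> R S T \<and>
        (\<forall>X\<in>{A, B, C}. \<forall>Y\<in>{R, S, T}. lie_bracket \<A> X Y = (\<lambda>p f. 0)))"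

end

theory Submission
  imports Defs
begin

text \<open>The tensors \<open>B\<^sup>\<H>\<close> and \<open>B\<^sup>\<V>\<close> are computed in a left-invariant orthonormal frame whose first six
  members span \<open>\<kk>\<close>. By the Koszul formula they vanish once \<open>ad E\<close>, for \<open>E \<in> \<kk>\<close>, acts skew-symmetrically on
  \<open>\<gg>/\<kk>\<close>, and \<open>ad Z\<close>, for \<open>Z\<close> orthogonal to \<open>\<kk>\<close>, has a skew-symmetric \<open>\<kk>\<close>-block. The first holds because
  \<open>\<gg>/\<kk>\<close> is a real representation of dimension two, on which \<open>su(2)\<close> can only act trivially. Hence
  \<open>ad Z\<close> maps \<open>\<kk>\<close> to itself and is a derivation of it; derivations of the semisimple algebra \<open>\<kk>\<close> are
  inner, and inner ones are skew-symmetric for the bi-invariant metric.\<close>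

section \<open>Calculus of smooth functions\<close>

text \<open>Codimension two is decisive: a nontrivial irreducible real representation of su(2) has
  dimension at least three. In matrix terms the action on \<gg>/\<kk> lands in sl(2,R), whose
  invariant form is indefinite, and this contradicts the su(2) relations unless all matrices vanish.
  Tangent vectors are abstract derivations of germs. Two facts therefore need their expression
  through partial derivatives, which Hadamard's lemma provides: left translates of a tangent vector
  form a smooth field, and an orthonormal family in a tangent space has at most eight members. That
  upper bound is the only dimension count made, so the frame is a family in which every tangent
  vector expands by its inner products, with last two members that are unit vectors or zero; all
  computations are phrased in components. Sections of the two distributions have variable
  coefficients in the frame. The derivatives of these coefficients disappear because each component
  is tested against a frame field orthogonal to both sections, which reduces everything to structure
  constants.\<close>

lemma Ck_on_subset: "Ck_on k S f \<Longrightarrow> T \<subseteq> S \<Longrightarrow> Ck_on k T f"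
  by (induction k arbitrary: f) (auto intro: continuous_on_subset)

lemma frechet_derivative_cong_open:
  assumes "open S" "x \<in> S" "\<And>y. y \<in> S \<Longrightarrow> f y = h y"
  shows "frechet_derivative f (at x) = frechet_derivative h (at x)"
proof -
  have "(f has_derivative D) (at x) \<longleftrightarrow> (h has_derivative D) (at x)" for D
    using assms has_derivative_transform_within_open[of f D x UNIV S h]
      has_derivative_transform_within_open[of h D x UNIV S f] by auto
  then show ?thesis by (simp add: frechet_derivative_def)
qed

lemma Ck_on_cong:
  assumes "Ck_on k S f" "open S" "\<And>x. x \<in> S \<Longrightarrow> f x = h x"
  shows "Ck_on k S h"
  using assms(1,3)
proof (induction k arbitrary: f h)
  case 0
  then show ?case using continuous_on_cong by force
next
  case (Suc k)
  have "h differentiable (at x)" if "x \<in> S" for x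
    using Suc.prems that \<open>open S\<close> has_derivative_transform_within_open[of f _ x UNIV S h]
    by (simp add: differentiable_def) blast
  moreover have "Ck_on k S (\<lambda>x. frechet_derivative h (at x) v)" for v
  proof (rule Suc.IH)
    show "Ck_on k S (\<lambda>x. frechet_derivative f (at x) v)" using Suc.prems(1) by simp
    show "frechet_derivative f (at x) v = frechet_derivative h (at x) v" if "x \<in> S" for x
      using frechet_derivative_cong_open[OF \<open>open S\<close> that Suc.prems(2)] by simp
  qed
  ultimately show ?case by simp
qed

lemma Ck_on_Suc_imp: "Ck_on (Suc k) S f \<Longrightarrow> Ck_on k S f"
proof (induction k arbitrary: f)
  case 0
  then show ?case
    by (auto intro!: continuous_at_imp_continuous_on differentiable_imp_continuous_within)
qed simp

lemma Ck_on_imp_continuous_on: "Ck_on k S f \<Longrightarrow> continuous_on S f"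
  by (induction k) (auto dest: Ck_on_Suc_imp simp del: Ck_on.simps(2))

lemma Ck_on_local:
  assumes "\<And>x. x \<in> S \<Longrightarrow> \<exists>T. open T \<and> x \<in> T \<and> Ck_on k T f"
  shows "Ck_on k S f"
  using assms
proof (induction k arbitrary: f)
  case 0
  then have "continuous (at x) f" if "x \<in> S" for x
    using that by (metis Ck_on.simps(1) continuous_on_eq_continuous_at)
  then show ?case by (simp add: continuous_at_imp_continuous_on)
next
  case (Suc k)
  have "f differentiable (at x)" if "x \<in> S" for x
    using Suc.prems[OF that] by auto
  moreover have "Ck_on k S (\<lambda>x. frechet_derivative f (at x) v)" for v
    using Suc.prems by (intro Suc.IH) (metis Ck_on.simps(2))
  ultimately show ?case by simp
qed

lemma Ck_on_const: "Ck_on k S (\<lambda>x. c)"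
  by (induction k arbitrary: c) (auto simp: frechet_derivative_const)

lemma Ck_on_affine:
  assumes "bounded_linear L"
  shows "Ck_on k S (\<lambda>x. L x + c)"
proof (cases k)
  case 0
  then show ?thesis
    using assms by (simp add: continuous_on_add bounded_linear.continuous_on[OF _ continuous_on_id])
next
  case (Suc m)
  have D: "((\<lambda>x. L x + c) has_derivative L) (at x)" for x
    by (intro has_derivative_add_const bounded_linear_imp_has_derivative assms)
  then have "frechet_derivative (\<lambda>x. L x + c) (at x) = L" for x
    using frechet_derivative_at by metis
  then show ?thesis using Suc D by (auto simp: Ck_on_const differentiable_def)
qed

lemma Ck_on_linear_compose:
  assumes "bounded_linear L" "Ck_on k S f" "open S"
  shows "Ck_on k S (\<lambda>x. L (f x))"
  using assms(2)
proof (induction k arbitrary: f)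
  case 0
  then show ?case using assms(1) by (simp add: bounded_linear.continuous_on)
next
  case (Suc k)
  have D: "((\<lambda>x. L (f x)) has_derivative (\<lambda>v. L (frechet_derivative f (at x) v))) (at x)"
    if "x \<in> S" for x
    using Suc.prems that by (intro bounded_linear.has_derivative[OF assms(1)])
      (simp add: frechet_derivative_works[symmetric])
  have "Ck_on k S (\<lambda>x. frechet_derivative (\<lambda>x. L (f x)) (at x) v)" for v
    by (rule Ck_on_cong[OF Suc.IH[of "\<lambda>x. frechet_derivative f (at x) v"] \<open>open S\<close>])
      (use Suc.prems in \<open>auto simp: frechet_derivative_at[OF D, symmetric]\<close>)
  then show ?case using D by (auto simp: differentiable_def)
qed

lemma Ck_on_add:
  assumes "Ck_on k S f" "Ck_on k S h" "open S"
  shows "Ck_on k S (\<lambda>x. f x + h x)"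
  using assms(1,2)
proof (induction k arbitrary: f h)
  case 0
  then show ?case unfolding Ck_on.simps by (intro continuous_on_add)
next
  case (Suc k)
  have D: "((\<lambda>x. f x + h x) has_derivative
      (\<lambda>v. frechet_derivative f (at x) v + frechet_derivative h (at x) v)) (at x)"
    if "x \<in> S" for x
    using Suc.prems that by (intro has_derivative_add)
      (simp_all add: frechet_derivative_works[symmetric])
  have "Ck_on k S (\<lambda>x. frechet_derivative (\<lambda>x. f x + h x) (at x) v)" for v
    by (rule Ck_on_cong[OF Suc.IH[of "\<lambda>x. frechet_derivative f (at x) v"
            "\<lambda>x. frechet_derivative h (at x) v"] \<open>open S\<close>])
      (use Suc.prems in \<open>auto simp: frechet_derivative_at[OF D, symmetric]\<close>)
  then show ?case using D by (auto simp: differentiable_def)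
qed

lemma Ck_on_mult:
  fixes f h :: "'a::euclidean_space \<Rightarrow> real"
  assumes "Ck_on k S f" "Ck_on k S h" "open S"
  shows "Ck_on k S (\<lambda>x. f x * h x)"
  using assms(1,2)
proof (induction k arbitrary: f h)
  case 0
  then show ?case unfolding Ck_on.simps by (intro continuous_on_mult)
next
  case (Suc k)
  have D: "((\<lambda>x. f x * h x) has_derivative
      (\<lambda>v. f x * frechet_derivative h (at x) v + frechet_derivative f (at x) v * h x)) (at x)"
    if "x \<in> S" for x
    using Suc.prems that by (intro has_derivative_mult)
      (simp_all add: frechet_derivative_works[symmetric])
  have "Ck_on k S (\<lambda>x. frechet_derivative (\<lambda>x. f x * h x) (at x) v)" for v
  proof (rule Ck_on_cong[OF Ck_on_add \<open>open S\<close>])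
    show "Ck_on k S (\<lambda>x. f x * frechet_derivative h (at x) v)"
      using Suc.prems Ck_on_Suc_imp[of k S f] by (intro Suc.IH) auto
    show "Ck_on k S (\<lambda>x. frechet_derivative f (at x) v * h x)"
      using Suc.prems Ck_on_Suc_imp[of k S h] by (intro Suc.IH) auto
  qed (auto simp: \<open>open S\<close> frechet_derivative_at[OF D, symmetric])
  then show ?case using D by (auto simp: differentiable_def)
qed

lemma Ck_on_sum:
  assumes "\<And>i. i \<in> I \<Longrightarrow> Ck_on k S (f i)" "open S"
  shows "Ck_on k S (\<lambda>x. \<Sum>i\<in>I. f i x)"
  using assms
  by (induction I rule: infinite_finite_induct) (auto intro: Ck_on_const Ck_on_add)

lemma linear_euclidean_sum:
  fixes L :: "'a::euclidean_space \<Rightarrow> real"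
  assumes "linear L"
  shows "L w = (\<Sum>b\<in>Basis. (w \<bullet> b) * L b)"
proof -
  have "L w = L (\<Sum>b\<in>Basis. (w \<bullet> b) *\<^sub>R b)"
    by (simp add: euclidean_representation)
  then show ?thesis
    by (simp add: linear_sum[OF assms] linear_scale[OF assms])
qed

text \<open>Expanding the chain rule over a basis of the intermediate space turns the derivative of
  the composite into a finite sum of products of real functions, to which the induction hypothesis
  applies with a partial derivative in place of \<open>f\<close>.\<close>

lemma Ck_on_compose:
  fixes f :: "'b::euclidean_space \<Rightarrow> real"
  assumes "Ck_on k T f" "Ck_on k S h" "h ` S \<subseteq> T" "open S" "open T"
  shows "Ck_on k S (\<lambda>x. f (h x))"
  using assms(1,2)
proof (induction k arbitrary: f)
  case 0
  then show ?case using assms(3) by (auto intro: continuous_on_compose2)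
next
  case (Suc k)
  have L: "linear (frechet_derivative f (at (h x)))" if "x \<in> S" for x
    using Suc.prems(1) that assms(3)
    by (intro linear_frechet_derivative) auto
  have D: "((\<lambda>x. f (h x)) has_derivative
      (\<lambda>v. frechet_derivative f (at (h x)) (frechet_derivative h (at x) v))) (at x)"
    if "x \<in> S" for x
    using Suc.prems that assms(3)
    by (intro has_derivative_compose[of h _ x UNIV f])
      (auto simp: frechet_derivative_works[symmetric])
  have "Ck_on k S (\<lambda>x. frechet_derivative (\<lambda>x. f (h x)) (at x) v)" for v
  proof (rule Ck_on_cong[OF Ck_on_sum \<open>open S\<close>])
    show "Ck_on k S (\<lambda>x. (frechet_derivative h (at x) v \<bullet> b) * frechet_derivative f (at (h x)) b)"
      if "b \<in> Basis" for b
      using Suc.prems Ck_on_Suc_imp[of k S h] \<open>open S\<close>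
      by (intro Ck_on_mult Suc.IH Ck_on_linear_compose[OF bounded_linear_inner_left]) auto
  qed (auto simp: \<open>open S\<close> frechet_derivative_at[OF D, symmetric]
      linear_euclidean_sum[OF L])
  then show ?case using D by (auto simp: differentiable_def)
qed

section \<open>Radial integrals and Hadamard's lemma\<close>

lemma ball_radial_mem:
  fixes p x :: "'a::euclidean_space"
  assumes "x \<in> ball p r" "t \<in> {0..1}"
  shows "p + t *\<^sub>R (x - p) \<in> ball p r"
proof -
  have "p + t *\<^sub>R (x - p) = (1 - t) *\<^sub>R p + t *\<^sub>R x" by (simp add: algebra_simps)
  moreover have "p \<in> ball p r"
    using assms(1) by (auto dest: le_less_trans[OF zero_le_dist])
  ultimately show ?thesis
    using convexD[OF convex_ball[of p r], of p x "1 - t" t] assms by auto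
qed

lemma continuous_on_radial:
  fixes G :: "'a::euclidean_space \<Rightarrow> 'b::topological_space"
  assumes "continuous_on (ball p r) G"
  shows "continuous_on (ball p r \<times> cbox 0 1) (\<lambda>z. G (p + snd z *\<^sub>R (fst z - p)))"
proof (rule continuous_on_compose2[OF assms])
  show "continuous_on (ball p r \<times> cbox 0 1) (\<lambda>z. p + snd z *\<^sub>R (fst z - p))"
    by (intro continuous_intros)
  show "(\<lambda>z. p + snd z *\<^sub>R (fst z - p)) ` (ball p r \<times> cbox 0 1) \<subseteq> ball p r"
    using ball_radial_mem by fastforce
qed

lemma integrable_on_radial:
  fixes G :: "'a::euclidean_space \<Rightarrow> 'b::banach"
  assumes "continuous_on (ball p r) G" "x \<in> ball p r"
  shows "(\<lambda>t. t ^ n *\<^sub>R G (p + t *\<^sub>R (x - p))) integrable_on cbox 0 1"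
proof (intro integrable_continuous continuous_on_scaleR continuous_on_power continuous_on_id)
  show "continuous_on (cbox 0 1) (\<lambda>t. G (p + t *\<^sub>R (x - p)))"
    using continuous_on_compose2[OF continuous_on_radial[OF assms(1)], of "cbox 0 1" "\<lambda>t. (x, t)"] assms(2)
    by (simp add: continuous_on_Pair image_subset_iff)
qed

text \<open>Differentiation under the integral sign brings out one more factor \<open>t\<close>,
  which is why the weight \<open>t ^ n\<close> has arbitrary \<open>n\<close> in the
  induction.\<close>

lemma Ck_on_radial_integral:
  fixes G :: "'a::euclidean_space \<Rightarrow> real"
  assumes "Ck_on k (ball p r) G"
  shows "Ck_on k (ball p r) (\<lambda>x. integral {0..1} (\<lambda>t. t ^ n * G (p + t *\<^sub>R (x - p))))"
  using assms
proof (induction k arbitrary: G n)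
  case (0 G n)
  note seg = ball_radial_mem
  have "continuous_on (ball p r \<times> cbox 0 1) (\<lambda>(x, t::real). t ^ n * G (p + t *\<^sub>R (x - p)))"
    unfolding case_prod_unfold
    using 0 by (intro continuous_on_mult continuous_on_power continuous_on_snd continuous_on_id
        continuous_on_radial) simp_all
  then show ?case
    using integral_continuous_on_param[of "ball p r" 0 "1::real"] by simp
next
  case (Suc k G n)
  note seg = ball_radial_mem
  let ?B = "ball p r"
  \<comment> \<open>\<open>leibniz_rule\<close> takes the derivative as a continuous family of
    bounded operators; in finite dimension this continuity follows from that of the partial
    derivatives.\<close>
  define D where "D y = Blinfun (frechet_derivative G (at y))" for y
  have G: "(G has_derivative frechet_derivative G (at y)) (at y)" if "y \<in> ?B" for y
    using Suc.prems that by (simp add: frechet_derivative_works[symmetric])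
  have D: "blinfun_apply (D y) = frechet_derivative G (at y)" if "y \<in> ?B" for y
    using G[OF that] unfolding D_def
    by (intro bounded_linear_Blinfun_apply) (rule has_derivative_bounded_linear)
  have contD: "continuous_on ?B D"
  proof (rule continuous_on_blinfun_componentwise)
    fix i :: 'a
    have "continuous_on ?B (\<lambda>y. frechet_derivative G (at y) i)"
      by (rule Ck_on_imp_continuous_on[of k]) (use Suc.prems in simp)
    then show "continuous_on ?B (\<lambda>y. blinfun_apply (D y) i)"
      by (rule continuous_on_eq) (simp add: D)
  qed
  have contG: "continuous_on ?B G"
    using G by (meson continuous_at_imp_continuous_on has_derivative_continuous)
  let ?f = "\<lambda>x t. t ^ n * G (p + t *\<^sub>R (x - p))"
  let ?fx = "\<lambda>x t. t ^ Suc n *\<^sub>R D (p + t *\<^sub>R (x - p))"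
  have der: "((\<lambda>x. integral (cbox 0 1) (?f x)) has_derivative
      blinfun_apply (integral (cbox 0 1) (?fx x0))) (at x0 within ?B)" if "x0 \<in> ?B" for x0
  proof (rule leibniz_rule)
    fix x :: 'a and t :: real assume xt: "x \<in> ?B" "t \<in> cbox 0 1"
    have "((\<lambda>x. p + t *\<^sub>R (x - p)) has_derivative (\<lambda>v. t *\<^sub>R v)) (at x within ?B)"
      by (rule has_derivative_eq_rhs, (rule derivative_intros)+) simp
    from has_derivative_compose[OF this G[OF seg[OF xt(1)]]] xt
    have "((\<lambda>x. G (p + t *\<^sub>R (x - p))) has_derivative
        (\<lambda>v. frechet_derivative G (at (p + t *\<^sub>R (x - p))) (t *\<^sub>R v))) (at x within ?B)" by auto
    then have "((\<lambda>x. ?f x t) has_derivative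
        (\<lambda>v. t ^ n * frechet_derivative G (at (p + t *\<^sub>R (x - p))) (t *\<^sub>R v))) (at x within ?B)"
      by (rule has_derivative_mult_right)
    moreover have "linear (frechet_derivative G (at (p + t *\<^sub>R (x - p))))"
      using G[OF seg[OF xt(1)]] xt by (metis box_real(2) has_derivative_linear)
    ultimately show "((\<lambda>x. ?f x t) has_derivative blinfun_apply (?fx x t)) (at x within ?B)"
      using xt seg[OF xt(1), of t] by (auto simp: D scaleR_blinfun.rep_eq linear_scale algebra_simps)
  next
    fix x assume "x \<in> ?B"
    then show "?f x integrable_on cbox 0 1"
      using integrable_on_radial[OF contG] by simp
  next
    show "continuous_on (?B \<times> cbox 0 1) (\<lambda>(x, t). ?fx x t)"
      unfolding case_prod_unfold
      by (intro continuous_on_scaleR continuous_on_power continuous_on_snd continuous_on_id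
          continuous_on_radial contD)
  qed (use that in auto)
  have D': "((\<lambda>x. integral {0..1} (?f x)) has_derivative
      (\<lambda>v. integral {0..1} (\<lambda>t. t ^ Suc n * frechet_derivative G (at (p + t *\<^sub>R (x0 - p))) v))) (at x0)"
    if "x0 \<in> ?B" for x0
  proof -
    have int: "?fx x0 integrable_on cbox 0 1"
      using integrable_on_radial[OF contD that] .
    have "blinfun_apply (integral (cbox 0 1) (?fx x0)) v =
        integral {0..1} (\<lambda>t. t ^ Suc n * frechet_derivative G (at (p + t *\<^sub>R (x0 - p))) v)" for v
    proof -
      \<comment> \<open>Evaluation at \<open>v\<close> is linear and continuous on operators, so it
        passes under the integral and gives back a real integrand of the shape covered by the
        induction hypothesis.\<close>
      have "blinfun_apply (integral (cbox 0 1) (?fx x0)) v = integral (cbox 0 1) (\<lambda>t. blinfun_apply (?fx x0 t) v)"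
        using integral_linear[OF int, of "\<lambda>L. blinfun_apply L v"]
        by (simp add: o_def blinfun.bounded_linear_left)
      also have "\<dots> = integral {0..1} (\<lambda>t. t ^ Suc n * frechet_derivative G (at (p + t *\<^sub>R (x0 - p))) v)"
        unfolding cbox_interval
        by (intro integral_cong) (simp add: D[OF seg[OF that]] scaleR_blinfun.rep_eq)
      finally show ?thesis .
    qed
    then have "blinfun_apply (integral (cbox 0 1) (?fx x0)) =
        (\<lambda>v. integral {0..1} (\<lambda>t. t ^ Suc n * frechet_derivative G (at (p + t *\<^sub>R (x0 - p))) v))"
      by (rule ext)
    then show ?thesis
      using der[OF that] unfolding at_within_open[OF that open_ball] by simp
  qed
  have "Ck_on k ?B (\<lambda>x. frechet_derivative (\<lambda>x. integral {0..1} (?f x)) (at x) v)" for v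
    by (rule Ck_on_cong[OF Suc.IH[of "\<lambda>x. frechet_derivative G (at x) v" "Suc n"] open_ball])
      (use Suc.prems in \<open>auto simp: frechet_derivative_at[OF D', symmetric]\<close>)
  then show ?case using D' unfolding Ck_on.simps differentiable_def by blast
qed

text \<open>Integrating the derivative of \<open>f\<close> along the segment from \<open>p\<close>
  to \<open>x\<close> gives the formula, with \<open>h b\<close> the mean of the partial derivative
  in direction \<open>b\<close> over that segment. It lets a derivation at \<open>p\<close> be
  computed by the product rule.\<close>

lemma Hadamard:
  fixes f :: "'a::euclidean_space \<Rightarrow> real"
  assumes f: "smooth_on (ball p r) f"
  obtains h where "\<And>b. smooth_on (ball p r) (h b)"
    "\<And>b. h b p = frechet_derivative f (at p) b"
    "\<And>x. x \<in> ball p r \<Longrightarrow> f x = f p + (\<Sum>b\<in>Basis. ((x - p) \<bullet> b) * h b x)"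
proof
  let ?D = "\<lambda>y. frechet_derivative f (at y)"
  \<comment> \<open>The factor \<open>t ^ 0\<close> puts the integral in the form of
    \<open>Ck_on_radial_integral\<close>.\<close>
  define h where "h b x = integral {0..1} (\<lambda>t. t ^ 0 * ?D (p + t *\<^sub>R (x - p)) b)" for b x
  have Ck: "Ck_on k (ball p r) (\<lambda>y. ?D y b)" for k b
    using f unfolding smooth_on_def by (metis Ck_on.simps(2))
  show "smooth_on (ball p r) (h b)" for b
    unfolding smooth_on_def h_def using Ck by (intro allI Ck_on_radial_integral)
  show "h b p = ?D p b" for b
    by (simp add: h_def)
  fix x assume x: "x \<in> ball p r"
  have D: "(f has_derivative ?D y) (at y)" if "y \<in> ball p r" for y
    using f that unfolding smooth_on_def by (metis Ck_on.simps(2) frechet_derivative_works)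
  let ?c = "\<lambda>t. p + t *\<^sub>R (x - p)"
  have expand: "?D (?c t) (x - p) = (\<Sum>b\<in>Basis. ((x - p) \<bullet> b) * ?D (?c t) b)"
    if "t \<in> {0..1}" for t
    using linear_euclidean_sum[OF has_derivative_linear[OF D[OF ball_radial_mem[OF x that]]]] .
  have "((\<lambda>t. ?D (?c t) (x - p)) has_integral f (?c 1) - f (?c 0)) {0..1}"
  proof (rule fundamental_theorem_of_calculus)
    fix t :: real assume t: "t \<in> {0..1}"
    have "(?c has_derivative (\<lambda>s. s *\<^sub>R (x - p))) (at t within {0..1})"
      by (rule has_derivative_eq_rhs, (rule derivative_intros)+) simp
    from has_derivative_compose[OF this D[OF ball_radial_mem[OF x t]]]
    show "((\<lambda>t. f (?c t)) has_vector_derivative ?D (?c t) (x - p)) (at t within {0..1})"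
      unfolding has_vector_derivative_def
      by (simp add: linear_scale[OF has_derivative_linear[OF D[OF ball_radial_mem[OF x t]]]])
  qed simp
  then have "f x - f p = integral {0..1} (\<lambda>t. ?D (?c t) (x - p))"
    by (simp add: integral_unique)
  also have "\<dots> = integral {0..1} (\<lambda>t. \<Sum>b\<in>Basis. ((x - p) \<bullet> b) * ?D (?c t) b)"
    by (rule integral_cong) (rule expand)
  also have "\<dots> = (\<Sum>b\<in>Basis. integral {0..1} (\<lambda>t. ((x - p) \<bullet> b) * ?D (?c t) b))"
  proof (rule integral_sum)
    fix b :: 'a
    have "continuous_on (ball p r) (\<lambda>y. ?D y b)"
      using Ck[of 0 b] by simp
    from integrable_on_radial[OF this x, of 0]
    show "(\<lambda>t. ((x - p) \<bullet> b) * ?D (?c t) b) integrable_on {0..1}"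
      by (simp add: integrable_on_mult_right)
  qed simp
  finally show "f x = f p + (\<Sum>b\<in>Basis. ((x - p) \<bullet> b) * h b x)"
    by (simp add: h_def)
qed

section \<open>Tangent vectors and vector fields\<close>

lemma smooth_on_subset: "smooth_on S f \<Longrightarrow> T \<subseteq> S \<Longrightarrow> smooth_on T f"
  unfolding smooth_on_def using Ck_on_subset by blast

lemma smooth_on_cong:
  "smooth_on S f \<Longrightarrow> open S \<Longrightarrow> (\<And>x. x \<in> S \<Longrightarrow> f x = h x) \<Longrightarrow> smooth_on S h"
  unfolding smooth_on_def using Ck_on_cong by blast

lemma smooth_on_local:
  assumes "\<And>x. x \<in> S \<Longrightarrow> \<exists>T. open T \<and> x \<in> T \<and> smooth_on T f"
  shows "smooth_on S f"
  unfolding smooth_on_def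
  using assms by (intro allI Ck_on_local) (auto simp: smooth_on_def)

lemma smooth_on_compose:
  fixes f :: "'b::euclidean_space \<Rightarrow> real"
  assumes "smooth_on T f" "smooth_on S h" "h ` S \<subseteq> T" "open S" "open T"
  shows "smooth_on S (\<lambda>x. f (h x))"
  using assms unfolding smooth_on_def by (blast intro: Ck_on_compose)

lemma smooth_on_deriv: "smooth_on S f \<Longrightarrow> smooth_on S (\<lambda>x. frechet_derivative f (at x) v)"
  unfolding smooth_on_def by (metis Ck_on.simps(2))

lemma smooth_on_has_derivative:
  "smooth_on S f \<Longrightarrow> x \<in> S \<Longrightarrow> (f has_derivative frechet_derivative f (at x)) (at x)"
  unfolding smooth_on_def by (metis Ck_on.simps(2) frechet_derivative_works)

locale smooth_manifold =
  fixes \<A> :: "('g::topological_space, 'e::euclidean_space) chart set"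
  assumes atlas: "smooth_atlas \<A>"
begin

lemma chart_at:
  obtains U \<phi> where "(U, \<phi>) \<in> \<A>" "p \<in> U"
proof -
  have "p \<in> (\<Union>c\<in>\<A>. fst c)" using atlas by (simp add: smooth_atlas_def)
  then show ?thesis using that by auto
qed

lemma
  assumes "(U, \<phi>) \<in> \<A>"
  shows chart_open: "open U"
    and chart_image_open: "open W \<Longrightarrow> open (\<phi> ` (U \<inter> W))"
    and chart_inv: "q \<in> U \<Longrightarrow> inv_into U \<phi> (\<phi> q) = q"
    and chart_continuous: "continuous_on U \<phi>"
    and chart_inv_continuous: "continuous_on (\<phi> ` U) (inv_into U \<phi>)"
proof -
  have c: "is_chart (U, \<phi>)" using atlas assms by (auto simp: smooth_atlas_def)
  then show "open U" by (simp add: is_chart_def)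
  from c have h: "homeomorphism U (\<phi> ` U) \<phi> (inv_into U \<phi>)" by (simp add: is_chart_def)
  show "q \<in> U \<Longrightarrow> inv_into U \<phi> (\<phi> q) = q" "continuous_on U \<phi>"
    "continuous_on (\<phi> ` U) (inv_into U \<phi>)"
    using h by (auto simp: homeomorphism_def)
  assume "open W"
  have "openin (top_of_set (\<phi> ` U)) (\<phi> ` (U \<inter> W))"
    using homeomorphism_imp_open_map[OF h] \<open>open W\<close> by (simp add: openin_open_Int)
  then show "open (\<phi> ` (U \<inter> W))"
    using c openin_open_eq[of "\<phi> ` U"] by (auto simp: is_chart_def)
qed

lemma chart_preimage_open:
  assumes "(U, \<phi>) \<in> \<A>" "open S"
  shows "open (U \<inter> \<phi> -` S)"
  using continuous_open_preimage[OF chart_continuous chart_open] assms by blast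

lemma chart_transition:
  "(U, \<phi>) \<in> \<A> \<Longrightarrow> (V, \<psi>) \<in> \<A> \<Longrightarrow> smooth_on (\<phi> ` (U \<inter> V)) (\<lambda>x. \<psi> (inv_into U \<phi> x))"
  using atlas unfolding smooth_atlas_def by fast

lemma smooth_fun_on_chart:
  "smooth_fun_on \<A> W f \<Longrightarrow> (U, \<phi>) \<in> \<A> \<Longrightarrow> smooth_on (\<phi> ` (U \<inter> W)) (\<lambda>x. f (inv_into U \<phi> x))"
  unfolding smooth_fun_on_def by fast

lemma smooth_fun_on_subset: "smooth_fun_on \<A> W f \<Longrightarrow> W' \<subseteq> W \<Longrightarrow> smooth_fun_on \<A> W' f"
  unfolding smooth_fun_on_def by (fast elim: smooth_on_subset)

lemma smooth_fun_on_cong: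
  assumes "smooth_fun_on \<A> W f" "open W" "\<And>q. q \<in> W \<Longrightarrow> f q = h q"
  shows "smooth_fun_on \<A> W h"
  unfolding smooth_fun_on_def
proof clarify
  fix U \<phi> assume c: "(U, \<phi>) \<in> \<A>"
  show "smooth_on (\<phi> ` (U \<inter> W)) (\<lambda>x. h (inv_into U \<phi> x))"
    by (rule smooth_on_cong[OF smooth_fun_on_chart[OF assms(1) c] chart_image_open[OF c assms(2)]])
      (use assms(3) chart_inv[OF c] in auto)
qed

lemma smooth_fun_on_local:
  assumes "\<And>p. p \<in> W \<Longrightarrow> smooth_near \<A> p f"
  shows "smooth_fun_on \<A> W f"
  unfolding smooth_fun_on_def
proof clarify
  fix U \<phi> assume c: "(U, \<phi>) \<in> \<A>"
  show "smooth_on (\<phi> ` (U \<inter> W)) (\<lambda>x. f (inv_into U \<phi> x))"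
  proof (rule smooth_on_local)
    fix x assume "x \<in> \<phi> ` (U \<inter> W)"
    then obtain q where q: "x = \<phi> q" "q \<in> U" "q \<in> W" by auto
    obtain W' where "open W'" "q \<in> W'" "smooth_fun_on \<A> W' f"
      using assms[OF q(3)] by (auto simp: smooth_near_def)
    then show "\<exists>T. open T \<and> x \<in> T \<and> smooth_on T (\<lambda>x. f (inv_into U \<phi> x))"
      using q c by (intro exI[of _ "\<phi> ` (U \<inter> W')"]) (auto intro: chart_image_open smooth_fun_on_chart)
  qed
qed

text \<open>Smooth transition maps carry smoothness from one chart to all others, so a single chart
  around \<open>W\<close> decides.\<close>

lemma smooth_fun_on_by_chart:
  assumes c: "(U, \<phi>) \<in> \<A>" and W: "open W" "W \<subseteq> U"
    and f: "smooth_on (\<phi> ` W) (\<lambda>x. f (inv_into U \<phi> x))"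
  shows "smooth_fun_on \<A> W f"
  unfolding smooth_fun_on_def
proof clarify
  fix V \<psi> assume d: "(V, \<psi>) \<in> \<A>"
  have UW: "U \<inter> W = W" using W by auto
  have "smooth_on (\<psi> ` (V \<inter> W)) (\<lambda>x. f (inv_into U \<phi> (\<phi> (inv_into V \<psi> x))))"
  proof (rule smooth_on_compose[OF f])
    show "smooth_on (\<psi> ` (V \<inter> W)) (\<lambda>x. \<phi> (inv_into V \<psi> x))"
      by (rule smooth_on_subset[OF chart_transition[OF d c]]) (use W in auto)
    show "open (\<phi> ` W)" using chart_image_open[OF c W(1)] UW by simp
  qed (auto simp: chart_inv[OF d] chart_image_open[OF d W(1)])
  then show "smooth_on (\<psi> ` (V \<inter> W)) (\<lambda>x. f (inv_into V \<psi> x))"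
    by (rule smooth_on_cong[OF _ chart_image_open[OF d W(1)]])
      (use W in \<open>auto simp: chart_inv[OF d] chart_inv[OF c]\<close>)
qed

lemma smooth_fun_on_coord:
  assumes "(U, \<phi>) \<in> \<A>"
  shows "smooth_fun_on \<A> U (\<lambda>q. \<phi> q \<bullet> b)"
proof (rule smooth_fun_on_by_chart[OF assms chart_open[OF assms] order_refl])
  show "smooth_on (\<phi> ` U) (\<lambda>x. \<phi> (inv_into U \<phi> x) \<bullet> b)"
  proof (rule smooth_on_cong)
    show "smooth_on (\<phi> ` U) (\<lambda>x. x \<bullet> b)"
      using Ck_on_affine[OF bounded_linear_inner_left, of _ _ b 0] by (simp add: smooth_on_def)
    show "open (\<phi> ` U)" using chart_image_open[OF assms open_UNIV] by simp
  qed (auto simp: chart_inv[OF assms])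
qed

lemma smooth_fun_on_const: "smooth_fun_on \<A> W (\<lambda>q. c)"
  by (auto simp: smooth_fun_on_def smooth_on_def Ck_on_const)

lemma smooth_fun_on_add:
  "smooth_fun_on \<A> W f \<Longrightarrow> smooth_fun_on \<A> W h \<Longrightarrow> open W \<Longrightarrow> smooth_fun_on \<A> W (\<lambda>q. f q + h q)"
  unfolding smooth_fun_on_def smooth_on_def by (fast intro: Ck_on_add chart_image_open)

lemma smooth_fun_on_mult:
  "smooth_fun_on \<A> W f \<Longrightarrow> smooth_fun_on \<A> W h \<Longrightarrow> open W \<Longrightarrow> smooth_fun_on \<A> W (\<lambda>q. f q * h q)"
  unfolding smooth_fun_on_def smooth_on_def by (fast intro: Ck_on_mult chart_image_open)

lemma smooth_nearI: "smooth_fun_on \<A> W f \<Longrightarrow> open W \<Longrightarrow> p \<in> W \<Longrightarrow> smooth_near \<A> p f"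
  by (auto simp: smooth_near_def)

lemma smooth_near_const: "smooth_near \<A> p (\<lambda>q. c)"
  by (rule smooth_nearI[of UNIV]) (auto intro: smooth_fun_on_const)

lemma smooth_near_common:
  assumes "smooth_near \<A> p f" "smooth_near \<A> p h"
  obtains W where "open W" "p \<in> W" "smooth_fun_on \<A> W f" "smooth_fun_on \<A> W h"
proof -
  obtain W1 W2 where "open W1" "p \<in> W1" "smooth_fun_on \<A> W1 f"
    "open W2" "p \<in> W2" "smooth_fun_on \<A> W2 h"
    using assms by (auto simp: smooth_near_def)
  then show ?thesis by (intro that[of "W1 \<inter> W2"]) (auto elim: smooth_fun_on_subset)
qed

lemma smooth_near_add:
  "smooth_near \<A> p f \<Longrightarrow> smooth_near \<A> p h \<Longrightarrow> smooth_near \<A> p (\<lambda>q. f q + h q)"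
  by (erule (1) smooth_near_common) (blast intro: smooth_nearI smooth_fun_on_add)

lemma smooth_near_mult:
  "smooth_near \<A> p f \<Longrightarrow> smooth_near \<A> p h \<Longrightarrow> smooth_near \<A> p (\<lambda>q. f q * h q)"
  by (erule (1) smooth_near_common) (blast intro: smooth_nearI smooth_fun_on_mult)

lemma smooth_near_sum:
  "(\<And>i. i \<in> I \<Longrightarrow> smooth_near \<A> p (f i)) \<Longrightarrow> smooth_near \<A> p (\<lambda>q. \<Sum>i\<in>I. f i q)"
  by (induction I rule: infinite_finite_induct) (auto intro: smooth_near_const smooth_near_add)

lemma smooth_near_cong:
  assumes "smooth_near \<A> p f" "open W" "p \<in> W" "\<And>q. q \<in> W \<Longrightarrow> f q = h q"
  shows "smooth_near \<A> p h"
proof -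
  obtain W' where "open W'" "p \<in> W'" "smooth_fun_on \<A> W' f"
    using assms(1) by (auto simp: smooth_near_def)
  then have W': "open (W \<inter> W')" "p \<in> W \<inter> W'" "smooth_fun_on \<A> (W \<inter> W') f"
    using assms(2,3) by (auto elim: smooth_fun_on_subset)
  show ?thesis
    by (rule smooth_nearI[OF smooth_fun_on_cong[OF W'(3,1)] W'(1,2)]) (simp add: assms(4))
qed

section \<open>Tangent vectors as derivations\<close>

lemma tangent_undefined: "v \<in> tangent_space \<A> p \<Longrightarrow> \<not> smooth_near \<A> p f \<Longrightarrow> v f = 0"
  unfolding tangent_space_def by fast

lemma tangent_cong:
  "v \<in> tangent_space \<A> p \<Longrightarrow> smooth_near \<A> p f \<Longrightarrow> open W \<Longrightarrow> p \<in> W \<Longrightarrow>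
    (\<And>q. q \<in> W \<Longrightarrow> f q = h q) \<Longrightarrow> v f = v h"
  unfolding tangent_space_def by blast

lemma tangent_linear:
  "v \<in> tangent_space \<A> p \<Longrightarrow> smooth_near \<A> p f \<Longrightarrow> smooth_near \<A> p h \<Longrightarrow>
    v (\<lambda>q. a * f q + b * h q) = a * v f + b * v h"
  unfolding tangent_space_def by fast

lemma tangent_mult:
  "v \<in> tangent_space \<A> p \<Longrightarrow> smooth_near \<A> p f \<Longrightarrow> smooth_near \<A> p h \<Longrightarrow>
    v (\<lambda>q. f q * h q) = v f * h p + f p * v h"
  unfolding tangent_space_def by fast

lemma tangent_add:
  "v \<in> tangent_space \<A> p \<Longrightarrow> smooth_near \<A> p f \<Longrightarrow> smooth_near \<A> p h \<Longrightarrow>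
    v (\<lambda>q. f q + h q) = v f + v h"
  using tangent_linear[of v p f h 1 1] by simp

lemma tangent_diff:
  "v \<in> tangent_space \<A> p \<Longrightarrow> smooth_near \<A> p f \<Longrightarrow> smooth_near \<A> p h \<Longrightarrow>
    v (\<lambda>q. f q - h q) = v f - v h"
  using tangent_linear[of v p f h 1 "-1"] by simp

lemma tangent_const:
  assumes "v \<in> tangent_space \<A> p"
  shows "v (\<lambda>q. c) = 0"
proof -
  have "v (\<lambda>q. 1) = 0"
    using tangent_mult[OF assms smooth_near_const smooth_near_const, of 1 1] by simp
  then show ?thesis
    using tangent_linear[OF assms smooth_near_const smooth_near_const, of c 1 0 1] by simp
qed

lemma tangent_sum:
  assumes "v \<in> tangent_space \<A> p" "\<And>i. i \<in> I \<Longrightarrow> smooth_near \<A> p (f i)"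
  shows "v (\<lambda>q. \<Sum>i\<in>I. f i q) = (\<Sum>i\<in>I. v (f i))"
  using assms(2)
  by (induction I rule: infinite_finite_induct)
    (auto simp: tangent_const[OF assms(1)] tangent_add[OF assms(1)] smooth_near_sum)

text \<open>In \<open>tangent_space\<close> only one of two locally equal functions is assumed
  smooth near \<open>p\<close>; \<open>smooth_near_cong\<close> supplies the smoothness of the
  other, so the second premise may assume both.\<close>

lemma tangentI:
  assumes "\<And>f. \<not> smooth_near \<A> p f \<Longrightarrow> v f = 0"
    and "\<And>f h W. smooth_near \<A> p f \<Longrightarrow> smooth_near \<A> p h \<Longrightarrow> open W \<Longrightarrow> p \<in> W \<Longrightarrow>
      (\<And>q. q \<in> W \<Longrightarrow> f q = h q) \<Longrightarrow> v f = v h"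
    and "\<And>f h a b. smooth_near \<A> p f \<Longrightarrow> smooth_near \<A> p h \<Longrightarrow>
      v (\<lambda>q. a * f q + b * h q) = a * v f + b * v h"
    and "\<And>f h. smooth_near \<A> p f \<Longrightarrow> smooth_near \<A> p h \<Longrightarrow>
      v (\<lambda>q. f q * h q) = v f * h p + f p * v h"
  shows "v \<in> tangent_space \<A> p"
  unfolding tangent_space_def
proof (intro CollectI conjI allI impI)
  fix f h assume "smooth_near \<A> p f \<and> (\<exists>W. open W \<and> p \<in> W \<and> (\<forall>q\<in>W. f q = h q))"
  then obtain W where W: "smooth_near \<A> p f" "open W" "p \<in> W" "\<And>q. q \<in> W \<Longrightarrow> f q = h q"
    by blast
  from assms(2)[OF W(1) smooth_near_cong[OF W] W(2-4)] show "v f = v h" by simp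
qed (simp_all add: assms(1,3,4))

lemma tangent_lincomb:
  assumes "u \<in> tangent_space \<A> p" "v \<in> tangent_space \<A> p"
  shows "(\<lambda>f. a * u f + b * v f) \<in> tangent_space \<A> p"
proof (rule tangentI)
  show "a * u f + b * v f = a * u h + b * v h"
    if "smooth_near \<A> p f" "smooth_near \<A> p h" "open W" "p \<in> W" "\<And>q. q \<in> W \<Longrightarrow> f q = h q" for f h W
    using tangent_cong[OF assms(1) that(1,3-5)] tangent_cong[OF assms(2) that(1,3-5)] by simp
qed (simp_all add: tangent_undefined[OF assms(1)] tangent_undefined[OF assms(2)]
    tangent_linear[OF assms(1)] tangent_linear[OF assms(2)]
    tangent_mult[OF assms(1)] tangent_mult[OF assms(2)] algebra_simps)

lemma tangent_zero: "(\<lambda>f. 0) \<in> tangent_space \<A> p"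
  by (rule tangentI) auto

text \<open>After Hadamard's expansion the constant term is killed, and in each product the
  coordinate difference vanishes at \<open>p\<close>, so the product rule leaves only the value of
  \<open>h b\<close> there, a partial derivative.\<close>

lemma tangent_coords:
  assumes v: "v \<in> tangent_space \<A> p" and c: "(U, \<phi>) \<in> \<A>" "p \<in> U" and f: "smooth_near \<A> p f"
  shows "v f = (\<Sum>b\<in>Basis. v (\<lambda>q. \<phi> q \<bullet> b) *
    frechet_derivative (\<lambda>x. f (inv_into U \<phi> x)) (at (\<phi> p)) b)"
proof -
  let ?F = "\<lambda>x. f (inv_into U \<phi> x)"
  obtain W where W: "open W" "p \<in> W" "smooth_fun_on \<A> W f"
    using f by (auto simp: smooth_near_def)
  obtain r where r: "r > 0" "ball (\<phi> p) r \<subseteq> \<phi> ` (U \<inter> W)"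
    using chart_image_open[OF c(1) W(1)] c(2) W(2) open_contains_ball
    by (metis IntI image_eqI)
  have "smooth_on (ball (\<phi> p) r) ?F"
    using smooth_on_subset[OF smooth_fun_on_chart[OF W(3) c(1)] r(2)] .
  from Hadamard[OF this] obtain h where h: "\<And>b. smooth_on (ball (\<phi> p) r) (h b)"
    "\<And>b. h b (\<phi> p) = frechet_derivative ?F (at (\<phi> p)) b"
    "\<And>x. x \<in> ball (\<phi> p) r \<Longrightarrow> ?F x = ?F (\<phi> p) + (\<Sum>b\<in>Basis. ((x - \<phi> p) \<bullet> b) * h b x)"
    by blast
  define N where "N = U \<inter> \<phi> -` ball (\<phi> p) r"
  have N: "open N" "p \<in> N" "N \<subseteq> U" "\<phi> ` N = ball (\<phi> p) r"
    using chart_preimage_open[OF c(1)] c(2) r unfolding N_def by auto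
  have sh: "smooth_near \<A> p (\<lambda>q. h b (\<phi> q))" for b
  proof (rule smooth_nearI[OF smooth_fun_on_by_chart[OF c(1) N(1,3)] N(1,2)])
    show "smooth_on (\<phi> ` N) (\<lambda>x. h b (\<phi> (inv_into U \<phi> x)))"
      by (rule smooth_on_cong[of _ "h b"]) (use h(1) N r in \<open>auto simp: f_inv_into_f\<close>)
  qed
  have sc: "smooth_near \<A> p (\<lambda>q. \<phi> q \<bullet> b)" for b
    using smooth_nearI[OF smooth_fun_on_coord chart_open] c by blast
  have sd: "smooth_near \<A> p (\<lambda>q. \<phi> q \<bullet> b - \<phi> p \<bullet> b)" for b
    using smooth_near_add[OF sc smooth_near_const, of b "- (\<phi> p \<bullet> b)"] by simp
  have "v f = v (\<lambda>q. f p + (\<Sum>b\<in>Basis. (\<phi> q \<bullet> b - \<phi> p \<bullet> b) * h b (\<phi> q)))"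
  proof (rule tangent_cong[OF v f N(1,2)])
    fix q assume "q \<in> N"
    then show "f q = f p + (\<Sum>b\<in>Basis. (\<phi> q \<bullet> b - \<phi> p \<bullet> b) * h b (\<phi> q))"
      using h(3)[of "\<phi> q"] c by (auto simp: N_def chart_inv inner_diff_left)
  qed
  also have "\<dots> = (\<Sum>b\<in>Basis. v (\<lambda>q. (\<phi> q \<bullet> b - \<phi> p \<bullet> b) * h b (\<phi> q)))"
    by (simp add: tangent_add[OF v] tangent_const[OF v] tangent_sum[OF v]
        smooth_near_const smooth_near_sum smooth_near_mult sd sh)
  also have "\<dots> = (\<Sum>b\<in>Basis. v (\<lambda>q. \<phi> q \<bullet> b) * h b (\<phi> p))"
    by (simp add: tangent_mult[OF v sd sh] tangent_diff[OF v sc smooth_near_const] tangent_const[OF v])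
  finally show ?thesis by (simp add: h(2))
qed

section \<open>Smooth vector fields\<close>

lemma vector_field_tangent: "smooth_vector_field \<A> X \<Longrightarrow> X p \<in> tangent_space \<A> p"
  by (simp add: smooth_vector_field_def)

lemma vector_field_apply_smooth:
  "smooth_vector_field \<A> X \<Longrightarrow> smooth_near \<A> p f \<Longrightarrow> smooth_near \<A> p (\<lambda>q. X q f)"
  unfolding smooth_vector_field_def smooth_near_def by blast

lemma vector_fieldI:
  assumes "\<And>p. X p \<in> tangent_space \<A> p"
    and "\<And>p f. smooth_near \<A> p f \<Longrightarrow> smooth_near \<A> p (\<lambda>q. X q f)"
  shows "smooth_vector_field \<A> X"
  unfolding smooth_vector_field_def
proof (intro conjI allI impI smooth_fun_on_local assms)
  fix W f p assume "open W \<and> smooth_fun_on \<A> W f" "p \<in> W"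
  then show "smooth_near \<A> p f" by (blast intro: smooth_nearI)
qed

lemma vector_field_lincomb:
  assumes "smooth_vector_field \<A> X" "smooth_vector_field \<A> Y"
    "smooth_fun_on \<A> UNIV a" "smooth_fun_on \<A> UNIV b"
  shows "smooth_vector_field \<A> (\<lambda>p f. a p * X p f + b p * Y p f)"
proof (rule vector_fieldI)
  have "smooth_near \<A> p a" "smooth_near \<A> p b" for p
    by (intro smooth_nearI[OF assms(3)] smooth_nearI[OF assms(4)] open_UNIV UNIV_I)+
  then show "smooth_near \<A> p (\<lambda>q. a q * X q f + b q * Y q f)" if "smooth_near \<A> p f" for p f
    using vector_field_apply_smooth[OF assms(1) that] vector_field_apply_smooth[OF assms(2) that]
    by (simp add: smooth_near_add smooth_near_mult)
qed (intro tangent_lincomb vector_field_tangent assms)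

lemma vector_field_sum:
  assumes "\<And>i. i < n \<Longrightarrow> smooth_vector_field \<A> (X i)" "\<And>i. i < n \<Longrightarrow> smooth_fun_on \<A> UNIV (a i)"
  shows "smooth_vector_field \<A> (\<lambda>p f. \<Sum>i<(n::nat). a i p * X i p f)"
  using assms
proof (induction n)
  case 0
  then show ?case by (auto intro!: vector_fieldI tangent_zero smooth_near_const)
next
  case (Suc n)
  then show ?case
    using vector_field_lincomb[of "\<lambda>p f. \<Sum>i<n. a i p * X i p f" "X n" "\<lambda>p. 1" "a n"]
    by (simp add: smooth_fun_on_const)
qed

end

section \<open>Left-invariant vector fields\<close>

lemma smooth_on_Pair_const:
  "smooth_on S (\<lambda>y. (c, y))" "smooth_on S (\<lambda>x. (x, c))"
proof -
  have "Ck_on k S (\<lambda>y. (c, y))" "Ck_on k S (\<lambda>x. (x, c))" for k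
    using Ck_on_affine[of "\<lambda>y. (0, y)" k S "(c, 0)"] Ck_on_affine[of "\<lambda>x. (x, 0)" k S "(0, c)"]
    by (simp_all add: bounded_linear_Pair bounded_linear_zero bounded_linear_ident)
  then show "smooth_on S (\<lambda>y. (c, y))" "smooth_on S (\<lambda>x. (x, c))"
    by (simp_all add: smooth_on_def)
qed

lemma smooth_on_linear_combination:
  fixes f :: "'i \<Rightarrow> 'a::euclidean_space \<Rightarrow> real"
  assumes "\<And>i. i \<in> I \<Longrightarrow> smooth_on S (f i)" "open S"
  shows "smooth_on S (\<lambda>x. \<Sum>i\<in>I. a i * f i x)"
  using assms unfolding smooth_on_def by (auto intro!: Ck_on_sum Ck_on_mult Ck_on_const)

locale lie_group_manifold =
  fixes G :: "'g::{t2_space, second_countable_topology} monoid"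
    and \<A> :: "('g, 'e::euclidean_space) chart set"
  assumes lie: "lie_group G \<A>"
begin

sublocale smooth_manifold \<A>
  using lie by unfold_locales (simp add: lie_group_def)

sublocale group G
  using lie by (simp add: lie_group_def)

lemma carrier_UNIV [simp]: "carrier G = UNIV"
  using lie by (simp add: lie_group_def)

lemma continuous_mult: "continuous_on UNIV (\<lambda>z. fst z \<otimes>\<^bsub>G\<^esub> snd z)"
  using lie by (simp add: lie_group_def case_prod_unfold)

text \<open>Coordinate form of the set of pairs whose product lies in \<open>W\<close>; for a chart
  domain \<open>W\<close> it is the domain that occurs in \<open>lie_group\<close>.\<close>

definition mult_dom where
  "mult_dom U \<phi> V \<psi> W =
    {(x, y). x \<in> \<phi> ` U \<and> y \<in> \<psi> ` V \<and> inv_into U \<phi> x \<otimes>\<^bsub>G\<^esub> inv_into V \<psi> y \<in> W}"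

lemma open_mult_dom:
  assumes c: "(U, \<phi>) \<in> \<A>" and d: "(V, \<psi>) \<in> \<A>" and "open W"
  shows "open (mult_dom U \<phi> V \<psi> W)"
proof -
  let ?S = "\<phi> ` U \<times> \<psi> ` V"
  let ?m = "\<lambda>z. inv_into U \<phi> (fst z) \<otimes>\<^bsub>G\<^esub> inv_into V \<psi> (snd z)"
  have "continuous_on ?S (\<lambda>z. (inv_into U \<phi> (fst z), inv_into V \<psi> (snd z)))"
    by (intro continuous_on_Pair continuous_on_compose2[OF chart_inv_continuous[OF c]]
        continuous_on_compose2[OF chart_inv_continuous[OF d]] continuous_on_fst continuous_on_snd
        continuous_on_id) auto
  from continuous_on_compose2[OF continuous_mult this] have "continuous_on ?S ?m" by simp
  moreover have "open ?S"
    using chart_image_open[OF c open_UNIV] chart_image_open[OF d open_UNIV] by (simp add: open_Times)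
  ultimately have "open (?S \<inter> ?m -` W)"
    using \<open>open W\<close> by (rule continuous_open_preimage)
  moreover have "?S \<inter> ?m -` W = mult_dom U \<phi> V \<psi> W"
    by (auto simp: mult_dom_def)
  ultimately show ?thesis by simp
qed

lemma smooth_mult:
  assumes f: "smooth_fun_on \<A> W f" "open W" and c: "(U, \<phi>) \<in> \<A>" and d: "(V, \<psi>) \<in> \<A>"
  shows "smooth_on (mult_dom U \<phi> V \<psi> W) (\<lambda>(x, y). f (inv_into U \<phi> x \<otimes>\<^bsub>G\<^esub> inv_into V \<psi> y))"
    (is "smooth_on _ ?F")
proof (rule smooth_on_local)
  fix z assume z: "z \<in> mult_dom U \<phi> V \<psi> W"
  let ?m = "\<lambda>z. inv_into U \<phi> (fst z) \<otimes>\<^bsub>G\<^esub> inv_into V \<psi> (snd z)"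
  obtain Y \<xi> where e: "(Y, \<xi>) \<in> \<A>" "?m z \<in> Y" by (rule chart_at)
  let ?T = "mult_dom U \<phi> V \<psi> (Y \<inter> W)"
  have oT: "open ?T" using open_mult_dom[OF c d] chart_open[OF e(1)] f(2) by blast
  have "smooth_on (mult_dom U \<phi> V \<psi> Y) (\<lambda>(x, y). \<xi> (inv_into U \<phi> x \<otimes>\<^bsub>G\<^esub> inv_into V \<psi> y))"
    using lie c d e(1) unfolding lie_group_def mult_dom_def by fast
  then have h: "smooth_on ?T (\<lambda>z. \<xi> (?m z))"
    unfolding case_prod_unfold by (rule smooth_on_subset) (auto simp: mult_dom_def)
  have "smooth_on ?T (\<lambda>z. f (inv_into Y \<xi> (\<xi> (?m z))))"
    by (rule smooth_on_compose[OF smooth_fun_on_chart[OF f(1) e(1)] h _ oT chart_image_open[OF e(1) f(2)]])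
      (auto simp: mult_dom_def)
  then have "smooth_on ?T ?F"
    by (rule smooth_on_cong[OF _ oT]) (auto simp: mult_dom_def chart_inv[OF e(1)])
  moreover have "z \<in> ?T" using z e(2) by (auto simp: mult_dom_def)
  ultimately show "\<exists>T. open T \<and> z \<in> T \<and> smooth_on T ?F" using oT by blast
qed

section \<open>Left translations and invariant fields\<close>

lemma open_translate:
  assumes "open W"
  shows "open {q. a \<otimes>\<^bsub>G\<^esub> q \<in> W}"
proof -
  have "continuous_on UNIV (\<lambda>q. a \<otimes>\<^bsub>G\<^esub> q)"
    using continuous_on_compose2[OF continuous_mult, of UNIV "\<lambda>q. (a, q)"]
    by (simp add: continuous_on_Pair)
  from open_vimage[OF assms this] show ?thesis by (simp add: vimage_def)
qed

text \<open>Left translation by \<open>a\<close> is multiplication restricted to the slice where the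
  first chart variable is fixed at the coordinates of \<open>a\<close>.\<close>

lemma smooth_fun_on_translate:
  assumes f: "smooth_fun_on \<A> W f" "open W"
  shows "smooth_fun_on \<A> {q. a \<otimes>\<^bsub>G\<^esub> q \<in> W} (\<lambda>q. f (a \<otimes>\<^bsub>G\<^esub> q))"
  unfolding smooth_fun_on_def
proof clarify
  fix V \<psi> assume d: "(V, \<psi>) \<in> \<A>"
  obtain U \<phi> where c: "(U, \<phi>) \<in> \<A>" "a \<in> U" by (rule chart_at)
  let ?S = "\<psi> ` (V \<inter> {q. a \<otimes>\<^bsub>G\<^esub> q \<in> W})"
  let ?F = "\<lambda>(x, y). f (inv_into U \<phi> x \<otimes>\<^bsub>G\<^esub> inv_into V \<psi> y)"
  have "smooth_on ?S (\<lambda>y. ?F (\<phi> a, y))"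
    by (rule smooth_on_compose[OF smooth_mult[OF f c(1) d] smooth_on_Pair_const(1) _
          chart_image_open[OF d open_translate[OF f(2)]] open_mult_dom[OF c(1) d f(2)]])
      (use c d in \<open>auto simp: mult_dom_def chart_inv\<close>)
  then show "smooth_on ?S (\<lambda>x. f (a \<otimes>\<^bsub>G\<^esub> inv_into V \<psi> x))"
    by (simp add: chart_inv[OF c])
qed

lemma inv_mult_cancel [simp]:
  "inv\<^bsub>G\<^esub> a \<otimes>\<^bsub>G\<^esub> (a \<otimes>\<^bsub>G\<^esub> q) = q" "a \<otimes>\<^bsub>G\<^esub> (inv\<^bsub>G\<^esub> a \<otimes>\<^bsub>G\<^esub> q) = q"
  by (simp_all add: m_assoc[symmetric])

text \<open>The converse comes from translating back by the inverse. It is this direction that makes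
  \<open>push_left\<close> respect the convention that tangent vectors vanish on functions that are
  not smooth nearby.\<close>

lemma smooth_near_translate: "smooth_near \<A> p (\<lambda>q. f (a \<otimes>\<^bsub>G\<^esub> q)) \<longleftrightarrow> smooth_near \<A> (a \<otimes>\<^bsub>G\<^esub> p) f"
proof -
  have *: "smooth_near \<A> p (\<lambda>q. f (a \<otimes>\<^bsub>G\<^esub> q))" if "smooth_near \<A> (a \<otimes>\<^bsub>G\<^esub> p) f" for a p f
  proof -
    obtain W where "open W" "a \<otimes>\<^bsub>G\<^esub> p \<in> W" "smooth_fun_on \<A> W f"
      using \<open>smooth_near \<A> (a \<otimes>\<^bsub>G\<^esub> p) f\<close> by (auto simp: smooth_near_def)
    then show ?thesis
      by (intro smooth_nearI[OF smooth_fun_on_translate[of W f a]]) (auto simp: open_translate)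
  qed
  show ?thesis
    using *[of a p f] *[of "inv\<^bsub>G\<^esub> a" "a \<otimes>\<^bsub>G\<^esub> p" "\<lambda>q. f (a \<otimes>\<^bsub>G\<^esub> q)"] by auto
qed

lemma push_left_tangent:
  assumes v: "v \<in> tangent_space \<A> p"
  shows "push_left G a v \<in> tangent_space \<A> (a \<otimes>\<^bsub>G\<^esub> p)"
proof (rule tangentI)
  fix f assume "\<not> smooth_near \<A> (a \<otimes>\<^bsub>G\<^esub> p) f"
  then show "push_left G a v f = 0"
    using tangent_undefined[OF v] smooth_near_translate by (simp add: push_left_def)
next
  fix f h W
  assume "smooth_near \<A> (a \<otimes>\<^bsub>G\<^esub> p) f" "open W" "a \<otimes>\<^bsub>G\<^esub> p \<in> W" "\<And>q. q \<in> W \<Longrightarrow> f q = h q"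
  then show "push_left G a v f = push_left G a v h"
    unfolding push_left_def
    by (intro tangent_cong[OF v _ open_translate]) (auto simp: smooth_near_translate)
qed (simp_all add: push_left_def tangent_linear[OF v] tangent_mult[OF v] smooth_near_translate)

lemma push_left_push_left: "push_left G a (push_left G b v) = push_left G (a \<otimes>\<^bsub>G\<^esub> b) v"
  by (simp add: push_left_def m_assoc)

lemma push_left_one: "push_left G \<one>\<^bsub>G\<^esub> v = v"
  by (simp add: push_left_def)

lemma left_invariantD:
  assumes "X \<in> left_invariant_fields G \<A>"
  shows "smooth_vector_field \<A> X" "X (a \<otimes>\<^bsub>G\<^esub> p) = push_left G a (X p)" "X p = push_left G p (X \<one>\<^bsub>G\<^esub>)"
proof -
  show "smooth_vector_field \<A> X" and *: "X (a \<otimes>\<^bsub>G\<^esub> p) = push_left G a (X p)" for a p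
    using assms by (auto simp: left_invariant_fields_def)
  show "X p = push_left G p (X \<one>\<^bsub>G\<^esub>)"
    using *[of p "\<one>\<^bsub>G\<^esub>"] by simp
qed

text \<open>The value on \<open>f\<close> is the derivative of \<open>f (p \<otimes> q)\<close> in
  the variable \<open>q\<close> at the identity. Once \<open>v\<close> is written in coordinates
  this is a fixed combination of partial derivatives in the second chart variable, and joint
  smoothness of multiplication makes them smooth in \<open>p\<close>.\<close>

lemma left_invariant_extension:
  assumes v: "v \<in> tangent_space \<A> \<one>\<^bsub>G\<^esub>"
  shows "(\<lambda>p. push_left G p v) \<in> left_invariant_fields G \<A>"
  unfolding left_invariant_fields_def
proof (intro CollectI conjI allI vector_fieldI)
  show "push_left G p v \<in> tangent_space \<A> p" for p
    using push_left_tangent[OF v, of p] by simp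
  show "push_left G (a \<otimes>\<^bsub>G\<^esub> p) v = push_left G a (push_left G p v)" for a p
    by (simp add: push_left_push_left)
  fix p0 f assume "smooth_near \<A> p0 f"
  then obtain W where W: "open W" "p0 \<in> W" "smooth_fun_on \<A> W f"
    by (auto simp: smooth_near_def)
  obtain U \<phi> where c: "(U, \<phi>) \<in> \<A>" "p0 \<in> U" by (rule chart_at)
  obtain V \<psi> where d: "(V, \<psi>) \<in> \<A>" "\<one>\<^bsub>G\<^esub> \<in> V" by (rule chart_at)
  let ?o = "\<psi> \<one>\<^bsub>G\<^esub>"
  let ?M = "mult_dom U \<phi> V \<psi> W"
  define F where "F = (\<lambda>(x, y). f (inv_into U \<phi> x \<otimes>\<^bsub>G\<^esub> inv_into V \<psi> y))"
  let ?DF = "\<lambda>x. frechet_derivative F (at (x, ?o))"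
  have F: "smooth_on ?M F" unfolding F_def by (rule smooth_mult[OF W(3,1) c(1) d(1)])
  have M: "(\<phi> p, ?o) \<in> ?M" if "p \<in> U \<inter> W" for p
    using that d c by (auto simp: mult_dom_def chart_inv)
  have *: "push_left G p v f = (\<Sum>b\<in>Basis. v (\<lambda>q. \<psi> q \<bullet> b) * ?DF (\<phi> p) (0, b))"
    if p: "p \<in> U \<inter> W" for p
  proof -
    have "smooth_near \<A> (p \<otimes>\<^bsub>G\<^esub> \<one>\<^bsub>G\<^esub>) f" using p W by (auto simp: smooth_near_def)
    then have sm: "smooth_near \<A> \<one>\<^bsub>G\<^esub> (\<lambda>q. f (p \<otimes>\<^bsub>G\<^esub> q))"
      unfolding smooth_near_translate .
    have "((\<lambda>y. (\<phi> p, y)) has_derivative (\<lambda>w. (0, w))) (at ?o)"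
      by (intro has_derivative_Pair has_derivative_const has_derivative_ident)
    from has_derivative_compose[OF this smooth_on_has_derivative[OF F M[OF p]]]
    have "((\<lambda>y. f (p \<otimes>\<^bsub>G\<^esub> inv_into V \<psi> y)) has_derivative (\<lambda>w. ?DF (\<phi> p) (0, w))) (at ?o)"
      using p by (simp add: F_def chart_inv[OF c(1)])
    from frechet_derivative_at[OF this] show ?thesis
      unfolding push_left_def tangent_coords[OF v d sm] by metis
  qed
  have "smooth_fun_on \<A> (U \<inter> W) (\<lambda>p. push_left G p v f)"
  proof (rule smooth_fun_on_by_chart[OF c(1)])
    show "open (U \<inter> W)" using chart_open[OF c(1)] W(1) by blast
    have o: "open (\<phi> ` (U \<inter> W))" by (rule chart_image_open[OF c(1) W(1)])
    have "smooth_on (\<phi> ` (U \<inter> W)) (\<lambda>x. \<Sum>b\<in>Basis. v (\<lambda>q. \<psi> q \<bullet> b) * ?DF x (0, b))"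
      by (intro smooth_on_linear_combination o
          smooth_on_compose[OF smooth_on_deriv[OF F] smooth_on_Pair_const(2) _ _
            open_mult_dom[OF c(1) d(1) W(1)]])
        (use M in auto)
    then show "smooth_on (\<phi> ` (U \<inter> W)) (\<lambda>x. push_left G (inv_into U \<phi> x) v f)"
      by (rule smooth_on_cong[OF _ o]) (use * in \<open>auto simp: chart_inv[OF c(1)]\<close>)
  qed simp
  then show "smooth_near \<A> p0 (\<lambda>q. push_left G q v f)"
    using chart_open[OF c(1)] W c(2) by (intro smooth_nearI[of "U \<inter> W"]) auto
qed

lemma lie_bracket_left_invariant:
  assumes "X \<in> left_invariant_fields G \<A>" "Y \<in> left_invariant_fields G \<A>"
  shows "lie_bracket \<A> X Y (a \<otimes>\<^bsub>G\<^esub> p) = push_left G a (lie_bracket \<A> X Y p)"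
  by (rule ext)
    (simp add: lie_bracket_def left_invariantD(2)[OF assms(1)] left_invariantD(2)[OF assms(2)]
      push_left_def smooth_near_translate)

end

section \<open>Algebra of the Lie bracket\<close>

context smooth_manifold
begin

lemma lie_bracket_antisym: "lie_bracket \<A> Y X p f = - lie_bracket \<A> X Y p f"
  by (simp add: lie_bracket_def)

lemma lie_bracket_linear_combination:
  assumes X: "smooth_vector_field \<A> X" and Y: "\<And>i. i < (n::nat) \<Longrightarrow> smooth_vector_field \<A> (Y i)"
  shows "lie_bracket \<A> X (\<lambda>p f. \<Sum>i<n. c i * Y i p f) p f = (\<Sum>i<n. c i * lie_bracket \<A> X (Y i) p f)"
proof (cases "smooth_near \<A> p f")
  case True
  have s: "smooth_near \<A> p (\<lambda>q. Y i q f)" if "i < n" for i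
    using vector_field_apply_smooth[OF Y[OF that] True] .
  have "X p (\<lambda>q. \<Sum>i<n. c i * Y i q f) = (\<Sum>i<n. X p (\<lambda>q. c i * Y i q f))"
    by (rule tangent_sum[OF vector_field_tangent[OF X]]) (simp add: s smooth_near_mult smooth_near_const)
  also have "\<dots> = (\<Sum>i<n. c i * X p (\<lambda>q. Y i q f))"
    using s by (intro sum.cong refl)
      (simp add: tangent_mult[OF vector_field_tangent[OF X]] tangent_const[OF vector_field_tangent[OF X]]
        smooth_near_const)
  finally show ?thesis
    using True by (simp add: lie_bracket_def sum_subtractf right_diff_distrib)
qed (simp add: lie_bracket_def)

text \<open>Because of its guard, \<open>lie_bracket\<close> agrees with the bare commutator only at
  points where \<open>f\<close> is smooth. These fill a neighbourhood of \<open>p\<close>, and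
  \<open>X p\<close> sees only the germ there.\<close>

lemma lie_bracket_apply:
  assumes X: "smooth_vector_field \<A> X" and Y: "smooth_vector_field \<A> Y"
    and Z: "smooth_vector_field \<A> Z" and f: "smooth_near \<A> p f"
  shows "X p (\<lambda>q. lie_bracket \<A> Y Z q f) = X p (\<lambda>q. Y q (\<lambda>r. Z r f)) - X p (\<lambda>q. Z q (\<lambda>r. Y r f))"
proof -
  obtain W where W: "open W" "p \<in> W" "smooth_fun_on \<A> W f"
    using f by (auto simp: smooth_near_def)
  have s: "smooth_near \<A> p (\<lambda>q. Y q (\<lambda>r. Z r f))" "smooth_near \<A> p (\<lambda>q. Z q (\<lambda>r. Y r f))"
    using vector_field_apply_smooth[OF Y vector_field_apply_smooth[OF Z f]]
      vector_field_apply_smooth[OF Z vector_field_apply_smooth[OF Y f]] .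
  have s': "smooth_near \<A> p (\<lambda>q. Y q (\<lambda>r. Z r f) - Z q (\<lambda>r. Y r f))"
    using smooth_near_add[OF s(1) smooth_near_mult[OF smooth_near_const s(2)], of "-1"] by simp
  have "X p (\<lambda>q. Y q (\<lambda>r. Z r f) - Z q (\<lambda>r. Y r f)) = X p (\<lambda>q. lie_bracket \<A> Y Z q f)"
    by (rule tangent_cong[OF vector_field_tangent[OF X] s' W(1,2)])
      (simp add: lie_bracket_def smooth_nearI[OF W(3,1)])
  then show ?thesis
    using tangent_diff[OF vector_field_tangent[OF X] s] by simp
qed

text \<open>Each double bracket expands into four iterated derivatives of third order, and the
  twelve terms cancel in pairs.\<close>

lemma lie_bracket_Jacobi:
  assumes X: "smooth_vector_field \<A> X" and Y: "smooth_vector_field \<A> Y"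
    and Z: "smooth_vector_field \<A> Z"
  shows "lie_bracket \<A> X (lie_bracket \<A> Y Z) p f + lie_bracket \<A> Y (lie_bracket \<A> Z X) p f
    + lie_bracket \<A> Z (lie_bracket \<A> X Y) p f = 0"
proof (cases "smooth_near \<A> p f")
  case True
  have *: "lie_bracket \<A> X (lie_bracket \<A> Y Z) p f =
      X p (\<lambda>q. Y q (\<lambda>r. Z r f)) - X p (\<lambda>q. Z q (\<lambda>r. Y r f))
      - (Y p (\<lambda>q. Z q (\<lambda>r. X r f)) - Z p (\<lambda>q. Y q (\<lambda>r. X r f)))"
    if X: "smooth_vector_field \<A> X" and Y: "smooth_vector_field \<A> Y"
    and Z: "smooth_vector_field \<A> Z" for X Y Z
  proof -
    have "lie_bracket \<A> X (lie_bracket \<A> Y Z) p f =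
        X p (\<lambda>q. lie_bracket \<A> Y Z q f) - lie_bracket \<A> Y Z p (\<lambda>q. X q f)"
      using True by (simp add: lie_bracket_def[of \<A> X])
    moreover have "lie_bracket \<A> Y Z p (\<lambda>q. X q f) =
        Y p (\<lambda>q. Z q (\<lambda>r. X r f)) - Z p (\<lambda>q. Y q (\<lambda>r. X r f))"
      using vector_field_apply_smooth[OF X True] by (simp add: lie_bracket_def)
    ultimately show ?thesis
      by (simp only: lie_bracket_apply[OF X Y Z True])
  qed
  show ?thesis
    by (simp only: *[OF X Y Z] *[OF Y Z X] *[OF Z X Y])
qed (simp add: lie_bracket_def)

end

section \<open>Structure constants of a codimension two extension of su(2) x su(2)\<close>

text \<open>The hypotheses are the su(2) relations for real 2 by 2 matrices. Being commutators, the
  matrices are traceless, and the indefinite invariant form on traceless matrices evaluates the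
  triple product with two opposite signs.\<close>

lemma su2_real_rep_dim2_trivial:
  fixes a b c :: "nat \<Rightarrow> nat \<Rightarrow> real"
  assumes "\<And>k l. k < 2 \<Longrightarrow> l < 2 \<Longrightarrow> 2 * c k l = (\<Sum>m<2. a k m * b m l - b k m * a m l)"
    and "\<And>k l. k < 2 \<Longrightarrow> l < 2 \<Longrightarrow> 2 * a k l = (\<Sum>m<2. b k m * c m l - c k m * b m l)"
    and "\<And>k l. k < 2 \<Longrightarrow> l < 2 \<Longrightarrow> 2 * b k l = (\<Sum>m<2. c k m * a m l - a k m * c m l)"
    and "k < 2" "l < 2"
  shows "a k l = 0" "b k l = 0" "c k l = 0"
proof -
  \<comment> \<open>Coordinates on traceless matrices: the diagonal entry, the symmetric
    off-diagonal part \<open>?s\<close> and the rotation part \<open>?u\<close>. The relations in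
    \<open>rel\<close> are conditional because the tracelessness of each matrix comes from a
    different one of its three instances.\<close>
  let ?s = "\<lambda>x::nat \<Rightarrow> nat \<Rightarrow> real. x 0 1 + x 1 0" and ?u = "\<lambda>x::nat \<Rightarrow> nat \<Rightarrow> real. x 0 1 - x 1 0"
  have rel: "x 1 1 = - x 0 0 \<and> y 1 1 = - y 0 0 \<and> z 1 1 = - z 0 0 \<longrightarrow>
      4 * z 0 0 = ?u x * ?s y - ?s x * ?u y \<and>
      ?u z = x 0 0 * ?s y - y 0 0 * ?s x \<and> ?s z = x 0 0 * ?u y - y 0 0 * ?u x"
    "z 1 1 = - z 0 0"
    if *: "\<And>k l. k < 2 \<Longrightarrow> l < 2 \<Longrightarrow> 2 * z k l = (\<Sum>m<2. x k m * y m l - y k m * x m l)"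
    for x y z :: "nat \<Rightarrow> nat \<Rightarrow> real"
  proof -
    have "2 * z 0 0 = x 0 1 * y 1 0 - y 0 1 * x 1 0"
      "2 * z 1 1 = x 1 0 * y 0 1 - y 1 0 * x 0 1"
      "2 * z 0 1 = x 0 0 * y 0 1 + x 0 1 * y 1 1 - y 0 0 * x 0 1 - y 0 1 * x 1 1"
      "2 * z 1 0 = x 1 0 * y 0 0 + x 1 1 * y 1 0 - y 1 0 * x 0 0 - y 1 1 * x 1 0"
      using *[of 0 0] *[of 1 1] *[of 0 1] *[of 1 0] by (simp_all add: numeral_2_eq_2)
    then show "z 1 1 = - z 0 0" and
      "x 1 1 = - x 0 0 \<and> y 1 1 = - y 0 0 \<and> z 1 1 = - z 0 0 \<longrightarrow>
      4 * z 0 0 = ?u x * ?s y - ?s x * ?u y \<and>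
      ?u z = x 0 0 * ?s y - y 0 0 * ?s x \<and> ?s z = x 0 0 * ?u y - y 0 0 * ?u x"
      by (auto simp: algebra_simps)
  qed
  note A = rel[OF assms(2)] and B = rel[OF assms(3)] and C = rel[OF assms(1)]
  have p: "4 * c 0 0 = ?u a * ?s b - ?s a * ?u b" "4 * a 0 0 = ?u b * ?s c - ?s b * ?u c"
    "4 * b 0 0 = ?u c * ?s a - ?s c * ?u a"
    and u: "?u c = a 0 0 * ?s b - b 0 0 * ?s a" "?u a = b 0 0 * ?s c - c 0 0 * ?s b"
    "?u b = c 0 0 * ?s a - a 0 0 * ?s c"
    and s: "?s c = a 0 0 * ?u b - b 0 0 * ?u a" "?s a = b 0 0 * ?u c - c 0 0 * ?u b"
    "?s b = c 0 0 * ?u a - a 0 0 * ?u c"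
    using A B C by blast+
  have sum6: "p = 0 \<and> q = 0 \<and> r = 0 \<and> x = 0 \<and> y = 0 \<and> z = 0"
    if "p * (4 * p) + q * (4 * q) + r * (4 * r) + x * x + y * y + z * z = 0" for p q r x y z :: real
  proof -
    have "p * p = 0" "q * q = 0" "r * r = 0" "x * x = 0" "y * y = 0" "z * z = 0"
      using that zero_le_square[of p] zero_le_square[of q] zero_le_square[of r]
        zero_le_square[of x] zero_le_square[of y] zero_le_square[of z] by linarith+
    then show ?thesis by simp
  qed
  txt \<open>Invariant form of signature (2,1) on the traceless matrices: both
    \<open>4 (p\<^sub>a\<^sup>2 + p\<^sub>b\<^sup>2 + p\<^sub>c\<^sup>2)\<close> and \<open>- (u\<^sub>a\<^sup>2 + u\<^sub>b\<^sup>2 + u\<^sub>c\<^sup>2)\<close> equal the triple product of \<open>a\<close>, \<open>b\<close>, \<open>c\<close>.\<close>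
  have "a 0 0 * (4 * a 0 0) + b 0 0 * (4 * b 0 0) + c 0 0 * (4 * c 0 0)
      + ?u a * ?u a + ?u b * ?u b + ?u c * ?u c = 0"
  proof -
    have "a 0 0 * (?u b * ?s c - ?s b * ?u c) + b 0 0 * (?u c * ?s a - ?s c * ?u a)
      + c 0 0 * (?u a * ?s b - ?s a * ?u b)
      + ?u a * (b 0 0 * ?s c - c 0 0 * ?s b) + ?u b * (c 0 0 * ?s a - a 0 0 * ?s c)
      + ?u c * (a 0 0 * ?s b - b 0 0 * ?s a) = 0"
      by (simp only: right_diff_distrib ac_simps)
    then show ?thesis by (simp only: p u)
  qed
  then have "a 0 0 = 0 \<and> b 0 0 = 0 \<and> c 0 0 = 0 \<and> ?u a = 0 \<and> ?u b = 0 \<and> ?u c = 0"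
    by (rule sum6)
  with s A(2) B(2) C(2) have z: "x 0 0 = 0 \<and> x 1 1 = 0 \<and> x 0 1 = 0 \<and> x 1 0 = 0" if "x \<in> {a, b, c}" for x
    using that by auto
  have "k \<in> {0, 1}" "l \<in> {0, 1}" using assms(4,5) by auto
  then show "a k l = 0" "b k l = 0" "c k l = 0" using z by auto
qed

text \<open>Twice the Levi-Civita symbol on each of the index blocks 0, 1, 2 and 3, 4, 5, matching
  the order A, B, C, R, S, T; \<open>P\<close> lists the even permutations.\<close>

definition su2_su2_const :: "nat \<Rightarrow> nat \<Rightarrow> nat \<Rightarrow> real" where
  "su2_su2_const i j k =
    (let P = {(0,1,2), (1,2,0), (2,0,1), (3,4,5), (4,5,3), (5,3,4)}
     in if (i, j, k) \<in> P then 2 else if (j, i, k) \<in> P then - 2 else 0)"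

text \<open>Here \<open>c i j k\<close> stands for the component of the bracket of the basis vectors
  \<open>i\<close> and \<open>j\<close> along the basis vector \<open>k\<close>. Indices below 6
  belong to \<kk>, while 6 and 7 are transversal; \<open>subalgebra\<close> with \<open>k\<close>
  equal to 6 or 7 says that \<kk> is closed under brackets.\<close>

locale su2_su2_codim2 =
  fixes c :: "nat \<Rightarrow> nat \<Rightarrow> nat \<Rightarrow> real"
  assumes antisym: "c j i k = - c i j k"
    and Jacobi: "\<lbrakk>i < 8; j < 8; k < 8; l < 8\<rbrakk> \<Longrightarrow>
      (\<Sum>m<8. c j k m * c i m l + c k i m * c j m l + c i j m * c k m l) = 0"
    and subalgebra: "\<lbrakk>i < 6; j < 6; k < 8\<rbrakk> \<Longrightarrow> c i j k = su2_su2_const i j k"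
begin

lemma sum_8: "(\<Sum>m<8. f m) = (\<Sum>m<6. f m) + (\<Sum>m<2. f (6 + m))" for f :: "nat \<Rightarrow> real"
  by (simp add: eval_nat_numeral)

lemma su2_su2_const_outside: "k \<ge> 6 \<Longrightarrow> su2_su2_const i j k = 0"
  by (auto simp: su2_su2_const_def)

text \<open>This is the Jacobi identity read modulo \<kk>. Summation over indices in \<kk> leaves
  only the term of the bracket of \<open>i\<close> and \<open>j\<close>, since \<kk> is a
  subalgebra; summation over transversal indices gives the commutator of the two operators on
  \<gg>/\<kk>.\<close>

lemma quotient_rep:
  assumes "i < 6" "j < 6" "k < 2" "l < 2"
  shows "(\<Sum>m<6. su2_su2_const i j m * c m (6 + k) (6 + l)) =
    (\<Sum>m<2. c i (6 + m) (6 + l) * c j (6 + k) (6 + m) - c j (6 + m) (6 + l) * c i (6 + k) (6 + m))"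
proof -
  have "(\<Sum>m<6. c j (6 + k) m * c i m (6 + l) + c (6 + k) i m * c j m (6 + l) + c i j m * c (6 + k) m (6 + l))
      = (\<Sum>m<6. - (su2_su2_const i j m * c m (6 + k) (6 + l)))"
  proof (rule sum.cong[OF refl])
    fix m :: nat assume "m \<in> {..<6}"
    then show "c j (6 + k) m * c i m (6 + l) + c (6 + k) i m * c j m (6 + l) + c i j m * c (6 + k) m (6 + l)
        = - (su2_su2_const i j m * c m (6 + k) (6 + l))"
      using assms by (simp add: subalgebra su2_su2_const_outside antisym[of "6 + k" m])
  qed
  moreover have "(\<Sum>m<2. c j (6 + k) (6 + m) * c i (6 + m) (6 + l) + c (6 + k) i (6 + m) * c j (6 + m) (6 + l)
      + c i j (6 + m) * c (6 + k) (6 + m) (6 + l)) =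
    (\<Sum>m<2. c i (6 + m) (6 + l) * c j (6 + k) (6 + m) - c j (6 + m) (6 + l) * c i (6 + k) (6 + m))"
  proof (rule sum.cong[OF refl])
    fix m :: nat assume "m \<in> {..<2}"
    then show "c j (6 + k) (6 + m) * c i (6 + m) (6 + l) + c (6 + k) i (6 + m) * c j (6 + m) (6 + l)
      + c i j (6 + m) * c (6 + k) (6 + m) (6 + l) =
      c i (6 + m) (6 + l) * c j (6 + k) (6 + m) - c j (6 + m) (6 + l) * c i (6 + k) (6 + m)"
      using assms by (simp add: subalgebra su2_su2_const_outside antisym[of "6 + k" i])
  qed
  moreover have "(\<Sum>m<8. c j (6 + k) m * c i m (6 + l) + c (6 + k) i m * c j m (6 + l)
      + c i j m * c (6 + k) m (6 + l)) = 0"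
    using assms by (intro Jacobi) auto
  ultimately show ?thesis
    unfolding sum_8 by (simp add: sum_negf)
qed

lemma quotient_trivial:
  assumes "i < 6" "k < 2" "l < 2"
  shows "c i (6 + k) (6 + l) = 0"
proof -
  \<comment> \<open>The offset \<open>n\<close> selects the su(2) factor, whose basis is
    \<open>n\<close>, \<open>n + 1\<close>, \<open>n + 2\<close>.\<close>
  have su: "c i (6 + k) (6 + l) = 0" if "k < 2" "l < 2" "i \<in> {n, n + 1, n + 2}" "n = 0 \<or> n = 3" for i k l n
  proof -
    \<comment> \<open>Matrix of the action on \<gg>/\<kk>: the output component \<open>l\<close> is
      the row and the input \<open>k\<close> the column, so that matrix products match
      composition.\<close>
    let ?r = "\<lambda>i l k. c i (6 + k) (6 + l)"
    have r: "2 * ?r (n + 2) l k = (\<Sum>m<2. ?r n l m * ?r (n + 1) m k - ?r (n + 1) l m * ?r n m k)"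
      "2 * ?r n l k = (\<Sum>m<2. ?r (n + 1) l m * ?r (n + 2) m k - ?r (n + 2) l m * ?r (n + 1) m k)"
      "2 * ?r (n + 1) l k = (\<Sum>m<2. ?r (n + 2) l m * ?r n m k - ?r n l m * ?r (n + 2) m k)"
      if "l < 2" "k < 2" for k l
      using quotient_rep[of n "n + 1" k l] quotient_rep[of "n + 1" "n + 2" k l]
        quotient_rep[of "n + 2" n k l] that \<open>n = 0 \<or> n = 3\<close>
      by (auto simp: su2_su2_const_def numeral_2_eq_2[symmetric] lessThan_nat_numeral lessThan_Suc)
    show ?thesis
      using su2_real_rep_dim2_trivial[of "?r (n + 2)" "?r n" "?r (n + 1)" l k, OF r] that by auto
  qed
  have "i = 0 \<or> i = 1 \<or> i = 2 \<or> i = 3 \<or> i = 4 \<or> i = 5" using assms(1) by arith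
  then show ?thesis
    using su[of k l i 0] su[of k l i 3] assms(2,3) by (auto simp: numeral_2_eq_2[symmetric])
qed

text \<open>By \<open>quotient_trivial\<close> the bracket of \<kk> with a transversal vector has no
  transversal component, so all intermediate indices in the Jacobi identity can be restricted to
  \<kk>.\<close>

lemma ad_derivation:
  assumes "i < 6" "j < 6" "l < 6" "k < 2"
  shows "(\<Sum>m<6. su2_su2_const i j m * c (6 + k) m l) =
    (\<Sum>m<6. c (6 + k) i m * su2_su2_const m j l + c (6 + k) j m * su2_su2_const i m l)"
proof -
  have "(\<Sum>m<6. c j (6 + k) m * c i m l + c (6 + k) i m * c j m l + c i j m * c (6 + k) m l)
      = (\<Sum>m<6. su2_su2_const i j m * c (6 + k) m l -
        (c (6 + k) i m * su2_su2_const m j l + c (6 + k) j m * su2_su2_const i m l))"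
  proof (rule sum.cong[OF refl])
    fix m :: nat assume "m \<in> {..<6}"
    then show "c j (6 + k) m * c i m l + c (6 + k) i m * c j m l + c i j m * c (6 + k) m l
      = su2_su2_const i j m * c (6 + k) m l -
        (c (6 + k) i m * su2_su2_const m j l + c (6 + k) j m * su2_su2_const i m l)"
      using assms by (simp add: subalgebra[symmetric] antisym[of j "6 + k"] antisym[of j m])
  qed
  moreover have "(\<Sum>m<2. c j (6 + k) (6 + m) * c i (6 + m) l + c (6 + k) i (6 + m) * c j (6 + m) l
      + c i j (6 + m) * c (6 + k) (6 + m) l) = 0"
    using assms quotient_trivial
    by (intro sum.neutral ballI)
      (simp add: subalgebra su2_su2_const_outside antisym[of "6 + k" i])
  moreover have "(\<Sum>m<8. c j (6 + k) m * c i m l + c (6 + k) i m * c j m l + c i j m * c (6 + k) m l) = 0"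
    using assms by (intro Jacobi) auto
  ultimately show ?thesis
    unfolding sum_8 by (simp add: sum_subtractf)
qed

text \<open>The derivation property is a linear system for the 36 entries of the \<kk>-block, and it
  is solved outright. The solutions are skew within each factor and zero between the factors, as
  expected of inner derivations.\<close>

lemma ad_skew:
  assumes "i < 6" "j < 6" "k < 2"
  shows "c (6 + k) i j + c (6 + k) j i = 0"
proof -
  have sum_6: "(\<Sum>m<6. f m) = (\<Sum>m\<leftarrow>[0,1,2,3,4,5]. f m)" for f :: "nat \<Rightarrow> real"
    by (simp add: eval_nat_numeral)
  have J: "(\<Sum>m\<leftarrow>[0,1,2,3,4,5]. su2_su2_const i j m * c (6 + k) m l) =
    (\<Sum>m\<leftarrow>[0,1,2,3,4,5]. c (6 + k) i m * su2_su2_const m j l + c (6 + k) j m * su2_su2_const i m l)"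
    if "i < 6" "j < 6" "l < 6" for i j l
    using ad_derivation[OF that assms(3)] unfolding sum_6 .
  \<comment> \<open>The component along the bracket itself gives D22 = D00 + D11 and its cyclic
    shifts, which force a zero diagonal; the other components say that transposed entries are
    opposite.\<close>
  note J0 = J[of 0 1 0] J[of 0 1 1] J[of 0 1 2]
    J[of 1 2 0] J[of 1 2 1] J[of 1 2 2]
    J[of 2 0 0] J[of 2 0 1] J[of 2 0 2]
  have block0: "c (6 + k) 0 0 = 0" "c (6 + k) 1 1 = 0" "c (6 + k) 2 2 = 0"
    "c (6 + k) 0 1 + c (6 + k) 1 0 = 0" "c (6 + k) 0 2 + c (6 + k) 2 0 = 0" "c (6 + k) 1 2 + c (6 + k) 2 1 = 0"
    using J0[unfolded su2_su2_const_def, simplified] unfolding One_nat_def by - linarith+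
  note J3 = J[of 3 4 3] J[of 3 4 4] J[of 3 4 5]
    J[of 4 5 3] J[of 4 5 4] J[of 4 5 5]
    J[of 5 3 3] J[of 5 3 4] J[of 5 3 5]
  have block3: "c (6 + k) 3 3 = 0" "c (6 + k) 4 4 = 0" "c (6 + k) 5 5 = 0"
    "c (6 + k) 3 4 + c (6 + k) 4 3 = 0" "c (6 + k) 3 5 + c (6 + k) 5 3 = 0" "c (6 + k) 4 5 + c (6 + k) 5 4 = 0"
    using J3[unfolded su2_su2_const_def, simplified] unfolding One_nat_def by - linarith+
  \<comment> \<open>Vectors of different factors commute, so the derivation rule equates to zero a
    sum with one part in each factor. Both parts vanish, and since the factors have no centre the
    mixed entries are zero.\<close>
  note cross = J[of 0 3 4] J[of 0 3 5] J[of 0 4 5]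
    J[of 1 3 4] J[of 1 3 5] J[of 1 4 5]
    J[of 2 3 4] J[of 2 3 5] J[of 2 4 5]
    J[of 3 0 1] J[of 3 0 2] J[of 3 1 2]
    J[of 4 0 1] J[of 4 0 2] J[of 4 1 2]
    J[of 5 0 1] J[of 5 0 2] J[of 5 1 2]
  have "i = 0 \<or> i = 1 \<or> i = 2 \<or> i = 3 \<or> i = 4 \<or> i = 5"
    "j = 0 \<or> j = 1 \<or> j = 2 \<or> j = 3 \<or> j = 4 \<or> j = 5"
    using assms(1,2) by arith+
  then show ?thesis
    by (elim disjE; simp only: One_nat_def;
        insert block0[unfolded One_nat_def] block3 cross[unfolded su2_su2_const_def, simplified]; linarith)
qed

text \<open>Both skewness facts in the single form required by the second fundamental forms:
  \<open>e < 6\<close> serves the horizontal one, \<open>e \<ge> 6\<close> the vertical one.\<close>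

lemma skew_transversal:
  assumes "e < 8" "i < 8" "j < 8" "i < 6 \<longleftrightarrow> \<not> e < 6" "j < 6 \<longleftrightarrow> \<not> e < 6"
  shows "c i e j + c j e i = 0"
proof (cases "e < 6")
  case True
  then obtain k l where "i = 6 + k" "j = 6 + l" "k < 2" "l < 2"
    using assms le_Suc_ex[of 6 i] le_Suc_ex[of 6 j] by auto
  then show ?thesis
    using True quotient_trivial[of e k l] quotient_trivial[of e l k]
    by (simp add: antisym[of _ e])
next
  case False
  then obtain k where "e = 6 + k" "k < 2"
    using assms le_Suc_ex[of 6 e] by auto
  then show ?thesis
    using False assms ad_skew[of i j k] by (simp add: antisym[of i "6 + k"] antisym[of j "6 + k"])
qed

end

section \<open>Left-invariant Riemannian geometry\<close>

context smooth_manifold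
begin

lemma tangent_vector_sum:
  "(\<And>i. i < n \<Longrightarrow> u i \<in> tangent_space \<A> p) \<Longrightarrow> (\<lambda>f. \<Sum>i<(n::nat). a i * u i f) \<in> tangent_space \<A> p"
proof (induction n)
  case (Suc n)
  then show ?case
    using tangent_lincomb[of "\<lambda>f. \<Sum>i<n. a i * u i f" p "u n" 1 "a n"] by simp
qed (simp add: tangent_zero)

lemma tangent_vector_diff:
  "u \<in> tangent_space \<A> p \<Longrightarrow> v \<in> tangent_space \<A> p \<Longrightarrow> (\<lambda>f. u f - v f) \<in> tangent_space \<A> p"
  using tangent_lincomb[of u p v 1 "-1"] by simp

end

locale riemannian_manifold = smooth_manifold \<A>
  for \<A> :: "('g::topological_space, 'e::euclidean_space) chart set" +
  fixes g :: "'g metric"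
  assumes metric: "riemannian_metric \<A> g"
begin

lemma metric_lincomb:
  "u \<in> tangent_space \<A> p \<Longrightarrow> v \<in> tangent_space \<A> p \<Longrightarrow> w \<in> tangent_space \<A> p \<Longrightarrow>
    g p (\<lambda>f. a * u f + b * v f) w = a * g p u w + b * g p v w"
  by (rule metric[unfolded riemannian_metric_def, THEN conjunct1, rule_format]) auto

lemma metric_sym: "u \<in> tangent_space \<A> p \<Longrightarrow> v \<in> tangent_space \<A> p \<Longrightarrow> g p u v = g p v u"
  by (rule metric[unfolded riemannian_metric_def, THEN conjunct2, THEN conjunct1, rule_format]) auto

lemma metric_pos: "u \<in> tangent_space \<A> p \<Longrightarrow> u \<noteq> (\<lambda>f. 0) \<Longrightarrow> g p u u > 0"
  by (rule metric[unfolded riemannian_metric_def, THEN conjunct2, THEN conjunct2, THEN conjunct1, rule_format]) auto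

lemma metric_smooth:
  "smooth_vector_field \<A> X \<Longrightarrow> smooth_vector_field \<A> Y \<Longrightarrow> smooth_fun_on \<A> UNIV (\<lambda>p. g p (X p) (Y p))"
  by (rule metric[unfolded riemannian_metric_def, THEN conjunct2, THEN conjunct2, THEN conjunct2, rule_format]) auto

lemma metric_zero: "w \<in> tangent_space \<A> p \<Longrightarrow> g p (\<lambda>f. 0) w = 0"
  using metric_lincomb[of w p w w 0 0] by simp

lemma metric_scale:
  "u \<in> tangent_space \<A> p \<Longrightarrow> w \<in> tangent_space \<A> p \<Longrightarrow> g p (\<lambda>f. a * u f) w = a * g p u w"
  using metric_lincomb[of u p u w a 0] by simp

lemma metric_add:
  "u \<in> tangent_space \<A> p \<Longrightarrow> v \<in> tangent_space \<A> p \<Longrightarrow> w \<in> tangent_space \<A> p \<Longrightarrow>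
    g p (\<lambda>f. u f + v f) w = g p u w + g p v w"
  using metric_lincomb[of u p v w 1 1] by simp

lemma metric_diff:
  "u \<in> tangent_space \<A> p \<Longrightarrow> v \<in> tangent_space \<A> p \<Longrightarrow> w \<in> tangent_space \<A> p \<Longrightarrow>
    g p (\<lambda>f. u f - v f) w = g p u w - g p v w"
  using metric_lincomb[of u p v w 1 "-1"] by simp

lemma metric_sum:
  assumes "\<And>i. i < (n::nat) \<Longrightarrow> u i \<in> tangent_space \<A> p" "w \<in> tangent_space \<A> p"
  shows "g p (\<lambda>f. \<Sum>i<n. a i * u i f) w = (\<Sum>i<n. a i * g p (u i) w)"
  using assms(1)
proof (induction n)
  case (Suc n)
  then show ?case
    using metric_lincomb[of "\<lambda>f. \<Sum>i<n. a i * u i f" p "u n" w 1 "a n"] assms(2)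
    by (simp add: tangent_vector_sum)
qed (simp add: metric_zero assms(2))

text \<open>The coordinate map \<open>\<kappa>\<close> of a chart is injective on tangent vectors by
  \<open>tangent_coords\<close>, so an orthonormal family becomes an independent one in the model
  space.\<close>

lemma orthonormal_length_le_DIM:
  assumes u: "\<And>i. i < n \<Longrightarrow> u i \<in> tangent_space \<A> p"
    and on: "\<And>i j. i < n \<Longrightarrow> j < n \<Longrightarrow> g p (u i) (u j) = (if i = j then 1 else 0)"
  shows "n \<le> DIM('e)"
proof -
  obtain U \<phi> where c: "(U, \<phi>) \<in> \<A>" "p \<in> U" by (rule chart_at)
  define \<kappa> where "\<kappa> v = (\<Sum>b\<in>Basis. v (\<lambda>q. \<phi> q \<bullet> b) *\<^sub>R b)" for v :: "'g tvec"
  have \<kappa>0: "v = (\<lambda>f. 0)" if v: "v \<in> tangent_space \<A> p" and "\<kappa> v = 0" for v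
  proof
    fix f
    have "v (\<lambda>q. \<phi> q \<bullet> b) = 0" if "b \<in> Basis" for b
    proof -
      have "v (\<lambda>q. \<phi> q \<bullet> b) = \<kappa> v \<bullet> b" unfolding \<kappa>_def inner_sum_left_Basis[OF that] ..
      then show ?thesis using \<open>\<kappa> v = 0\<close> by simp
    qed
    then show "v f = 0"
      using tangent_coords[OF v c, of f] tangent_undefined[OF v, of f] by fastforce
  qed
  have lin: "\<kappa> (\<lambda>f. \<Sum>i<n. a i * u i f) = (\<Sum>i<n. a i *\<^sub>R \<kappa> (u i))" for a
    unfolding \<kappa>_def scaleR_sum_left scaleR_sum_right by (subst sum.swap) simp
  have coeff: "a j = 0" if "(\<Sum>i<n. a i *\<^sub>R \<kappa> (u i)) = 0" "j < n" for a j
  proof -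
    have "(\<lambda>f. \<Sum>i<n. a i * u i f) = (\<lambda>f. 0)"
      using that(1) lin[of a] by (intro \<kappa>0 tangent_vector_sum u) simp_all
    then have "0 = g p (\<lambda>f. \<Sum>i<n. a i * u i f) (u j)"
      using metric_zero[OF u[OF that(2)]] by simp
    also have "\<dots> = (\<Sum>i<n. a i * g p (u i) (u j))"
      by (rule metric_sum) (simp_all add: u that(2))
    also have "\<dots> = (\<Sum>i<n. if i = j then a i else 0)"
      using that(2) by (intro sum.cong) (simp_all add: on)
    also have "\<dots> = a j"
      using that(2) by simp
    finally show ?thesis by simp
  qed
  \<comment> \<open>Independence is a property of the image set; distinctness of the images makes
    its cardinality equal to \<open>n\<close>.\<close>
  have inj: "inj_on (\<lambda>i. \<kappa> (u i)) {..<n}"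
  proof (rule inj_onI, rule ccontr)
    fix i j assume ij: "i \<in> {..<n}" "j \<in> {..<n}" "\<kappa> (u i) = \<kappa> (u j)" "i \<noteq> j"
    have "(\<Sum>k<n. ((if k = i then 1 else 0) - (if k = j then 1 else 0)) *\<^sub>R \<kappa> (u k)) =
        (\<Sum>k<n. (if k = i then \<kappa> (u k) else 0) - (if k = j then \<kappa> (u k) else 0))"
      by (intro sum.cong) auto
    also have "\<dots> = 0"
      using ij by (simp add: sum_subtractf)
    finally show False
      using coeff[of "\<lambda>k. (if k = i then 1 else 0) - (if k = j then 1 else 0)" i] ij by auto
  qed
  have "independent ((\<lambda>i. \<kappa> (u i)) ` {..<n})"
  proof (rule independent_if_scalars_zero)
    fix f x assume f: "(\<Sum>x\<in>(\<lambda>i. \<kappa> (u i)) ` {..<n}. f x *\<^sub>R x) = 0" and x: "x \<in> (\<lambda>i. \<kappa> (u i)) ` {..<n}"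
    show "f x = 0"
      using coeff[of "\<lambda>i. f (\<kappa> (u i))"] f x by (auto simp: sum.reindex[OF inj])
  qed simp
  from independent_card_le[OF this] show ?thesis
    by (simp add: card_image[OF inj])
qed

text \<open>The new vector is \<open>0\<close> when the given ones already span, so that no lower bound for the
  dimension of the tangent space is needed.\<close>

lemma extend_orthonormal:
  assumes u: "\<And>i. i < n \<Longrightarrow> u i \<in> tangent_space \<A> p"
  obtains w where "w \<in> tangent_space \<A> p" "\<And>i. i < n \<Longrightarrow> g p w (u i) = 0"
    "\<And>v. g p w w \<noteq> 1 \<Longrightarrow> v \<in> tangent_space \<A> p \<Longrightarrow> (\<And>i. i < n \<Longrightarrow> g p v (u i) = 0) \<Longrightarrow> v = (\<lambda>f. 0)"
    "g p w w \<noteq> 1 \<Longrightarrow> w = (\<lambda>f. 0)"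
proof (cases "\<exists>v\<in>tangent_space \<A> p. v \<noteq> (\<lambda>f. 0) \<and> (\<forall>i<n. g p v (u i) = 0)")
  case True
  then obtain v where v: "v \<in> tangent_space \<A> p" "v \<noteq> (\<lambda>f. 0)" "\<forall>i<n. g p v (u i) = 0"
    by blast
  define r where "r = sqrt (g p v v)"
  have r: "r > 0" "g p v v = r * r"
    using metric_pos[OF v(1,2)] by (simp_all add: r_def)
  define w where "w = (\<lambda>f. (1 / r) * v f)"
  have w: "w \<in> tangent_space \<A> p"
    using tangent_lincomb[OF v(1) v(1), of "1 / r" 0] by (simp add: w_def)
  have *: "g p w x = (1 / r) * g p v x" if "x \<in> tangent_space \<A> p" for x
    unfolding w_def by (rule metric_scale[OF v(1) that])
  have "g p v w = (1 / r) * g p v v"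
    using metric_sym[OF v(1) w] *[OF v(1)] by simp
  then have "g p w w = 1" using *[OF w] r by simp
  with w * u v(3) show ?thesis by (intro that[of w]) auto
next
  case False
  then show ?thesis
    by (intro that[of "\<lambda>f. 0"]) (auto simp: tangent_zero metric_zero u)
qed

text \<open>The projection is a definite description, so uniqueness has to be shown: any other
  candidate \<open>w\<close> in \<open>W p\<close> is orthogonal to itself and vanishes by
  positivity.\<close>

lemma orth_projection_eq_zero:
  assumes "W p \<subseteq> tangent_space \<A> p" "(\<lambda>f. 0) \<in> W p" "Z p \<in> tangent_space \<A> p"
    and orth: "\<And>u. u \<in> W p \<Longrightarrow> g p (Z p) u = 0"
  shows "orth_projection g W Z p = (\<lambda>f. 0)"
  unfolding orth_projection_def
proof (rule the_equality)
  show "(\<lambda>f. 0) \<in> W p \<and> (\<forall>u\<in>W p. g p (\<lambda>f. Z p f - 0) u = 0)"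
    using assms(2) orth by simp
next
  fix w assume w: "w \<in> W p \<and> (\<forall>u\<in>W p. g p (\<lambda>f. Z p f - w f) u = 0)"
  then have wT: "w \<in> tangent_space \<A> p" using assms(1) by blast
  have "g p (\<lambda>f. Z p f - w f) w = 0" using w by blast
  then have "g p w w = 0"
    using metric_diff[OF assms(3) wT wT] orth w by simp
  then show "w = (\<lambda>f. 0)" using metric_pos[OF wT] by fastforce
qed

end

section \<open>Left-invariant metrics and their Levi-Civita connection\<close>

locale left_invariant_geometry = lie_group_manifold G \<A> + riemannian_manifold \<A> g
  for G :: "'g::{t2_space, second_countable_topology} monoid"
    and \<A> :: "('g, 'e::euclidean_space) chart set" and g +
  fixes D :: "'g vfield \<Rightarrow> 'g vfield \<Rightarrow> 'g vfield"
  assumes left_invariant: "left_invariant_metric G \<A> g"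
    and levi_civita: "levi_civita \<A> g D"
begin

lemma metric_push_left:
  "u \<in> tangent_space \<A> p \<Longrightarrow> v \<in> tangent_space \<A> p \<Longrightarrow>
    g (a \<otimes>\<^bsub>G\<^esub> p) (push_left G a u) (push_left G a v) = g p u v"
  by (rule left_invariant[unfolded left_invariant_metric_def, rule_format])

text \<open>Phrased by pointwise conditions, so that it applies directly to brackets of
  left-invariant fields.\<close>

lemma metric_left_invariant_fields:
  assumes "\<And>a p. X (a \<otimes>\<^bsub>G\<^esub> p) = push_left G a (X p)" "\<And>a p. Y (a \<otimes>\<^bsub>G\<^esub> p) = push_left G a (Y p)"
    "\<And>p. X p \<in> tangent_space \<A> p" "\<And>p. Y p \<in> tangent_space \<A> p"
  shows "g p (X p) (Y p) = g \<one>\<^bsub>G\<^esub> (X \<one>\<^bsub>G\<^esub>) (Y \<one>\<^bsub>G\<^esub>)"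
  using metric_push_left[OF assms(3,4), of p "\<one>\<^bsub>G\<^esub>"] assms(1,2)[of p "\<one>\<^bsub>G\<^esub>"] by simp

lemma connection_smooth:
  "smooth_vector_field \<A> X \<Longrightarrow> smooth_vector_field \<A> Y \<Longrightarrow> smooth_vector_field \<A> (D X Y)"
  by (rule levi_civita[unfolded levi_civita_def affine_connection_def, THEN conjunct1, THEN conjunct1, rule_format]) auto

lemma connection_lincomb:
  "smooth_vector_field \<A> X \<Longrightarrow> smooth_vector_field \<A> Y \<Longrightarrow> smooth_vector_field \<A> Z \<Longrightarrow>
    smooth_fun_on \<A> UNIV a \<Longrightarrow> smooth_fun_on \<A> UNIV b \<Longrightarrow>
    D (\<lambda>p f. a p * X p f + b p * Y p f) Z = (\<lambda>p f. a p * D X Z p f + b p * D Y Z p f)"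
  by (rule levi_civita[unfolded levi_civita_def affine_connection_def, THEN conjunct1, THEN conjunct2, THEN conjunct1, rule_format]) auto

lemma torsion_free:
  "smooth_vector_field \<A> X \<Longrightarrow> smooth_vector_field \<A> Y \<Longrightarrow>
    lie_bracket \<A> X Y = (\<lambda>p f. D X Y p f - D Y X p f)"
  by (rule levi_civita[unfolded levi_civita_def, THEN conjunct2, THEN conjunct1, rule_format, symmetric]) auto

lemma metric_compatible:
  "smooth_vector_field \<A> X \<Longrightarrow> smooth_vector_field \<A> Y \<Longrightarrow> smooth_vector_field \<A> Z \<Longrightarrow>
    X p (\<lambda>q. g q (Y q) (Z q)) = g p (D X Y p) (Z p) + g p (Y p) (D X Z p)"
  by (rule levi_civita[unfolded levi_civita_def, THEN conjunct2, THEN conjunct2, rule_format]) auto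

text \<open>Torsion-freeness exhibits the bracket as a difference of two fields that are smooth by
  the connection axioms.\<close>

lemma lie_bracket_smooth:
  assumes "smooth_vector_field \<A> X" "smooth_vector_field \<A> Y"
  shows "smooth_vector_field \<A> (lie_bracket \<A> X Y)"
  using vector_field_lincomb[OF connection_smooth[OF assms] connection_smooth[OF assms(2,1)]
      smooth_fun_on_const smooth_fun_on_const, of 1 "-1"]
  by (simp add: torsion_free[OF assms])

lemma connection_sum:
  assumes "\<And>i. i < n \<Longrightarrow> smooth_vector_field \<A> (X i)" "\<And>i. i < n \<Longrightarrow> smooth_fun_on \<A> UNIV (a i)"
    and Z: "smooth_vector_field \<A> Z"
  shows "D (\<lambda>p f. \<Sum>i<(n::nat). a i p * X i p f) Z = (\<lambda>p f. \<Sum>i<n. a i p * D (X i) Z p f)"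
  using assms(1,2)
proof (induction n)
  case 0
  then show ?case
    using connection_lincomb[OF Z Z Z smooth_fun_on_const smooth_fun_on_const, of 0 0] by simp
next
  case (Suc n)
  then show ?case
    using connection_lincomb[of "\<lambda>p f. \<Sum>i<n. a i p * X i p f" "X n" Z "\<lambda>p. 1" "a n"] Z
    by (simp add: vector_field_sum smooth_fun_on_const)
qed

end

section \<open>Left-invariant frames\<close>

text \<open>The frame is required to expand every tangent vector by its inner products, in the
  manner of a Parseval frame. This is what \<open>extend_orthonormal\<close> can deliver, since a
  zero member is compatible with such an expansion.\<close>

locale left_invariant_frame = left_invariant_geometry G \<A> g D
  for G :: "'g::{t2_space, second_countable_topology} monoid"
    and \<A> :: "('g, 'e::euclidean_space) chart set" and g D +
  fixes X :: "nat \<Rightarrow> 'g vfield"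
  assumes X_left_invariant: "i < 8 \<Longrightarrow> X i \<in> left_invariant_fields G \<A>"
    and Parseval: "v \<in> tangent_space \<A> p \<Longrightarrow> v = (\<lambda>f. \<Sum>i<8. g p v (X i p) * X i p f)"
begin

lemma X_smooth: "i < 8 \<Longrightarrow> smooth_vector_field \<A> (X i)"
  using left_invariantD(1)[OF X_left_invariant] .

lemma X_tangent: "i < 8 \<Longrightarrow> X i p \<in> tangent_space \<A> p"
  by (rule vector_field_tangent[OF X_smooth])

lemma metric_Parseval:
  assumes v: "v \<in> tangent_space \<A> p" and w: "w \<in> tangent_space \<A> p"
  shows "g p v w = (\<Sum>i<8. g p v (X i p) * g p w (X i p))"
proof -
  have "g p v w = g p (\<lambda>f. \<Sum>i<8. g p v (X i p) * X i p f) w"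
    by (rule arg_cong[OF Parseval[OF v]])
  also have "\<dots> = (\<Sum>i<8. g p v (X i p) * g p (X i p) w)"
    by (rule metric_sum[OF X_tangent w])
  also have "\<dots> = (\<Sum>i<8. g p v (X i p) * g p w (X i p))"
    by (intro sum.cong refl) (simp add: metric_sym[OF X_tangent w])
  finally show ?thesis .
qed

text \<open>Left invariance makes the value at the identity valid at every point. The default 0
  outside the index range lets antisymmetry hold for all indices, as \<open>su2_su2_codim2\<close>
  demands.\<close>

definition struct_const :: "nat \<Rightarrow> nat \<Rightarrow> nat \<Rightarrow> real" where
  "struct_const i j k = (if i < 8 \<and> j < 8 \<and> k < 8
    then g \<one>\<^bsub>G\<^esub> (lie_bracket \<A> (X i) (X j) \<one>\<^bsub>G\<^esub>) (X k \<one>\<^bsub>G\<^esub>) else 0)"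

lemma bracket_tangent: "i < 8 \<Longrightarrow> j < 8 \<Longrightarrow> lie_bracket \<A> (X i) (X j) p \<in> tangent_space \<A> p"
  by (rule vector_field_tangent[OF lie_bracket_smooth[OF X_smooth X_smooth]])

lemma struct_const:
  assumes "i < 8" "j < 8" "k < 8"
  shows "g p (lie_bracket \<A> (X i) (X j) p) (X k p) = struct_const i j k"
  using metric_left_invariant_fields[of "lie_bracket \<A> (X i) (X j)" "X k" p,
      OF lie_bracket_left_invariant[OF X_left_invariant X_left_invariant]
        left_invariantD(2)[OF X_left_invariant] bracket_tangent X_tangent] assms
  by (simp add: struct_const_def)

lemma bracket_expansion:
  assumes "i < 8" "j < 8"
  shows "lie_bracket \<A> (X i) (X j) = (\<lambda>p f. \<Sum>k<8. struct_const i j k * X k p f)"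
proof (rule ext)
  fix p
  have "lie_bracket \<A> (X i) (X j) p =
      (\<lambda>f. \<Sum>k<8. g p (lie_bracket \<A> (X i) (X j) p) (X k p) * X k p f)"
    by (rule Parseval[OF bracket_tangent[OF assms]])
  also have "\<dots> = (\<lambda>f. \<Sum>k<8. struct_const i j k * X k p f)"
    using assms by (simp add: struct_const)
  finally show "lie_bracket \<A> (X i) (X j) p = (\<lambda>f. \<Sum>k<8. struct_const i j k * X k p f)" .
qed

lemma struct_const_antisym: "struct_const j i k = - struct_const i j k"
proof (cases "i < 8 \<and> j < 8 \<and> k < 8")
  case True
  have "lie_bracket \<A> (X j) (X i) \<one>\<^bsub>G\<^esub> = (\<lambda>f. - 1 * lie_bracket \<A> (X i) (X j) \<one>\<^bsub>G\<^esub> f)"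
    by (rule ext) (simp add: lie_bracket_antisym[of "X j"])
  then show ?thesis
    using metric_scale[of "lie_bracket \<A> (X i) (X j) \<one>\<^bsub>G\<^esub>" "\<one>\<^bsub>G\<^esub>" "X k \<one>\<^bsub>G\<^esub>" "- 1"] True
    by (simp add: struct_const_def bracket_tangent X_tangent)
qed (auto simp: struct_const_def)

text \<open>The inner bracket of each term is expanded in the frame, and the identity of fields is
  then paired with \<open>X l\<close>; components are defined as inner products, so no comparison of
  coefficients takes place.\<close>

lemma struct_const_Jacobi:
  assumes i: "i < 8" and j: "j < 8" and k: "k < 8" and l: "l < 8"
  shows "(\<Sum>m<8. struct_const j k m * struct_const i m l + struct_const k i m * struct_const j m l
    + struct_const i j m * struct_const k m l) = 0"
proof -
  let ?B = "\<lambda>i j k. lie_bracket \<A> (X i) (lie_bracket \<A> (X j) (X k)) \<one>\<^bsub>G\<^esub>"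
  have T: "?B i j k \<in> tangent_space \<A> \<one>\<^bsub>G\<^esub>" if "i < 8" "j < 8" "k < 8" for i j k
    using that by (intro vector_field_tangent lie_bracket_smooth X_smooth)
  have comp: "g \<one>\<^bsub>G\<^esub> (?B i j k) (X l \<one>\<^bsub>G\<^esub>) = (\<Sum>m<8. struct_const j k m * struct_const i m l)"
    if "i < 8" "j < 8" "k < 8" for i j k
  proof -
    have "?B i j k = (\<lambda>f. \<Sum>m<8. struct_const j k m * lie_bracket \<A> (X i) (X m) \<one>\<^bsub>G\<^esub> f)"
      unfolding bracket_expansion[OF that(2,3)]
      by (rule ext) (rule lie_bracket_linear_combination[OF X_smooth[OF that(1)] X_smooth])
    then have "g \<one>\<^bsub>G\<^esub> (?B i j k) (X l \<one>\<^bsub>G\<^esub>) =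
        (\<Sum>m<8. struct_const j k m * g \<one>\<^bsub>G\<^esub> (lie_bracket \<A> (X i) (X m) \<one>\<^bsub>G\<^esub>) (X l \<one>\<^bsub>G\<^esub>))"
      by (simp only:) (rule metric_sum[OF bracket_tangent[OF that(1)] X_tangent[OF l]])
    also have "\<dots> = (\<Sum>m<8. struct_const j k m * struct_const i m l)"
      using that(1) l by (intro sum.cong refl) (simp add: struct_const)
    finally show ?thesis .
  qed
  have "(\<lambda>f. (?B i j k f + ?B j k i f) + ?B k i j f) = (\<lambda>f. 0)"
    by (rule ext) (rule lie_bracket_Jacobi[OF X_smooth[OF i] X_smooth[OF j] X_smooth[OF k]])
  then have "g \<one>\<^bsub>G\<^esub> (\<lambda>f. (?B i j k f + ?B j k i f) + ?B k i j f) (X l \<one>\<^bsub>G\<^esub>) = 0"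
    using metric_zero[OF X_tangent[OF l]] by simp
  then have "g \<one>\<^bsub>G\<^esub> (?B i j k) (X l \<one>\<^bsub>G\<^esub>) + g \<one>\<^bsub>G\<^esub> (?B j k i) (X l \<one>\<^bsub>G\<^esub>)
      + g \<one>\<^bsub>G\<^esub> (?B k i j) (X l \<one>\<^bsub>G\<^esub>) = 0"
    using metric_add[OF tangent_lincomb[OF T[OF i j k] T[OF j k i], of 1 1] T[OF k i j] X_tangent[OF l]]
      metric_add[OF T[OF i j k] T[OF j k i] X_tangent[OF l]] by simp
  then show ?thesis
    using comp i j k by (simp add: sum.distrib)
qed

section \<open>Connection coefficients in the frame\<close>

definition connection_coeff :: "'g \<Rightarrow> nat \<Rightarrow> nat \<Rightarrow> nat \<Rightarrow> real" where
  "connection_coeff p i j k = g p (D (X i) (X j) p) (X k p)"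

lemma connection_tangent:
  "smooth_vector_field \<A> E \<Longrightarrow> smooth_vector_field \<A> F \<Longrightarrow> D E F p \<in> tangent_space \<A> p"
  by (rule vector_field_tangent[OF connection_smooth])

text \<open>Inner products of left-invariant fields are constant, so the left-hand side of metric
  compatibility vanishes.\<close>

lemma connection_coeff_skew:
  assumes "i < 8" "j < 8" "k < 8"
  shows "connection_coeff p i k j = - connection_coeff p i j k"
proof -
  have "(\<lambda>q. g q (X j q) (X k q)) = (\<lambda>q. g \<one>\<^bsub>G\<^esub> (X j \<one>\<^bsub>G\<^esub>) (X k \<one>\<^bsub>G\<^esub>))"
    using assms by (intro ext metric_left_invariant_fields left_invariantD(2) X_left_invariant X_tangent)
  then have "X i p (\<lambda>q. g q (X j q) (X k q)) = 0"
    using tangent_const[OF X_tangent[OF assms(1)]] by simp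
  then show ?thesis
    using metric_compatible[OF X_smooth X_smooth X_smooth, of i j k p] assms
      metric_sym[OF connection_tangent[OF X_smooth X_smooth] X_tangent, of i k j p]
    by (simp add: connection_coeff_def)
qed

lemma connection_coeff_torsion:
  assumes "i < 8" "j < 8" "k < 8"
  shows "connection_coeff p i j k - connection_coeff p j i k = struct_const i j k"
  using metric_diff[OF connection_tangent[OF X_smooth X_smooth] connection_tangent[OF X_smooth X_smooth]
      X_tangent, of i j j i k p] assms
    struct_const[OF assms, of p] torsion_free[OF X_smooth X_smooth, of i j]
  by (simp add: connection_coeff_def)

text \<open>As \<open>F\<close> is orthogonal to \<open>X e\<close>, the derivatives of its components do not contribute.\<close>

lemma connection_component:
  assumes E: "smooth_vector_field \<A> E" and F: "smooth_vector_field \<A> F" and e: "e < 8"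
    and orth: "\<And>p. g p (F p) (X e p) = 0"
  shows "g p (D E F p) (X e p) =
    - (\<Sum>i<8. \<Sum>j<8. g p (E p) (X i p) * g p (F p) (X j p) * connection_coeff p i e j)"
proof -
  have coeff_smooth: "smooth_fun_on \<A> UNIV (\<lambda>p. g p (E p) (X i p))" if "i < 8" for i
    by (rule metric_smooth[OF E X_smooth[OF that]])
  have "E = (\<lambda>p f. \<Sum>i<8. g p (E p) (X i p) * X i p f)"
    by (rule ext) (rule Parseval[OF vector_field_tangent[OF E]])
  then have "D E (X e) = D (\<lambda>p f. \<Sum>i<8. g p (E p) (X i p) * X i p f) (X e)"
    by (rule arg_cong[where f = "\<lambda>E. D E (X e)"])
  also have "\<dots> = (\<lambda>p f. \<Sum>i<8. g p (E p) (X i p) * D (X i) (X e) p f)"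
    by (rule connection_sum[OF X_smooth coeff_smooth X_smooth[OF e]])
  finally have DE: "D E (X e) p = (\<lambda>f. \<Sum>i<8. g p (E p) (X i p) * D (X i) (X e) p f)"
    by (rule fun_cong)
  have T: "D (X i) (X e) p \<in> tangent_space \<A> p" if "i < 8" for i
    using connection_tangent[OF X_smooth[OF that] X_smooth[OF e]] .
  have FT: "F p \<in> tangent_space \<A> p" by (rule vector_field_tangent[OF F])
  have "E p (\<lambda>q. g q (F q) (X e q)) = 0"
    using tangent_const[OF vector_field_tangent[OF E]] by (simp add: orth)
  then have "g p (D E F p) (X e p) = - g p (F p) (D E (X e) p)"
    using metric_compatible[OF E F X_smooth[OF e], of p] by simp
  also have "g p (F p) (D E (X e) p) = g p (D E (X e) p) (F p)"
    by (rule metric_sym[OF FT connection_tangent[OF E X_smooth[OF e]]])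
  also have "\<dots> = (\<Sum>i<8. g p (E p) (X i p) * g p (D (X i) (X e) p) (F p))"
    unfolding DE by (rule metric_sum[OF T FT])
  also have "\<dots> = (\<Sum>i<8. \<Sum>j<8. g p (E p) (X i p) * g p (F p) (X j p) * connection_coeff p i e j)"
    by (intro sum.cong refl)
      (simp add: metric_Parseval[OF T FT] connection_coeff_def sum_distrib_left mult_ac)
  finally show ?thesis .
qed

text \<open>Koszul's formula in the frame. By torsion-freeness the sum of the coefficients
  \<open>i e j\<close> and \<open>j e i\<close> is the sum of the corresponding structure constants
  plus the coefficients \<open>e i j\<close> and \<open>e j i\<close>, which cancel by metric
  compatibility. Only indices along which \<open>E\<close> and \<open>F\<close> have a component
  contribute, whence the form of \<open>skew\<close>.\<close>

lemma connection_sym_component: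
  assumes E: "smooth_vector_field \<A> E" and F: "smooth_vector_field \<A> F" and e: "e < 8"
    and orth: "\<And>p. g p (E p) (X e p) = 0" "\<And>p. g p (F p) (X e p) = 0"
    and skew: "\<And>i j. i < 8 \<Longrightarrow> j < 8 \<Longrightarrow> g p (E p) (X i p) \<noteq> 0 \<Longrightarrow> g p (F p) (X j p) \<noteq> 0 \<Longrightarrow>
      struct_const i e j + struct_const j e i = 0"
  shows "g p (\<lambda>f. D E F p f + D F E p f) (X e p) = 0"
proof -
  let ?E = "\<lambda>i. g p (E p) (X i p)" and ?F = "\<lambda>i. g p (F p) (X i p)"
  have "g p (\<lambda>f. D E F p f + D F E p f) (X e p) = g p (D E F p) (X e p) + g p (D F E p) (X e p)"
    using connection_tangent[OF E F] connection_tangent[OF F E] X_tangent[OF e] by (rule metric_add)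
  also have "\<dots> = - (\<Sum>i<8. \<Sum>j<8. ?E i * ?F j * connection_coeff p i e j)
      - (\<Sum>i<8. \<Sum>j<8. ?F i * ?E j * connection_coeff p i e j)"
    by (simp add: connection_component[OF E F e orth(2)] connection_component[OF F E e orth(1)])
  also have "(\<Sum>i<8. \<Sum>j<8. ?F i * ?E j * connection_coeff p i e j) =
      (\<Sum>i<8. \<Sum>j<8. ?E i * ?F j * connection_coeff p j e i)"
    by (subst sum.swap) (simp add: mult_ac)
  also have "- (\<Sum>i<8. \<Sum>j<8. ?E i * ?F j * connection_coeff p i e j)
      - (\<Sum>i<8. \<Sum>j<8. ?E i * ?F j * connection_coeff p j e i) =
      - (\<Sum>i<8. \<Sum>j<8. ?E i * ?F j * (connection_coeff p i e j + connection_coeff p j e i))"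
    by (simp add: sum.distrib distrib_left)
  also have "(\<Sum>i<8. \<Sum>j<8. ?E i * ?F j * (connection_coeff p i e j + connection_coeff p j e i)) = 0"
  proof (intro sum.neutral ballI)
    fix i j :: nat assume "i \<in> {..<8}" "j \<in> {..<8}"
    then have ij: "i < 8" "j < 8" by auto
    have "connection_coeff p i e j + connection_coeff p j e i = struct_const i e j + struct_const j e i"
      using connection_coeff_torsion[OF ij(1) e ij(2), of p] connection_coeff_torsion[OF ij(2) e ij(1), of p]
        connection_coeff_skew[OF e ij, of p] by simp
    then show "?E i * ?F j * (connection_coeff p i e j + connection_coeff p j e i) = 0"
      using skew[OF ij] by fastforce
  qed
  finally show ?thesis by simp
qed

text \<open>Orthogonality to \<open>X e\<close> makes this component of the bracket tensorial, so
  that involutivity for sections with variable coefficients reduces to the structure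
  constants.\<close>

lemma bracket_component:
  assumes E: "smooth_vector_field \<A> E" and F: "smooth_vector_field \<A> F" and e: "e < 8"
    and orth: "\<And>p. g p (E p) (X e p) = 0" "\<And>p. g p (F p) (X e p) = 0"
  shows "g p (lie_bracket \<A> E F p) (X e p) =
    (\<Sum>i<8. \<Sum>j<8. g p (E p) (X i p) * g p (F p) (X j p) * struct_const i j e)"
proof -
  let ?E = "\<lambda>i. g p (E p) (X i p)" and ?F = "\<lambda>i. g p (F p) (X i p)"
  have "g p (lie_bracket \<A> E F p) (X e p) = g p (D E F p) (X e p) - g p (D F E p) (X e p)"
    unfolding torsion_free[OF E F]
    using connection_tangent[OF E F] connection_tangent[OF F E] X_tangent[OF e] by (rule metric_diff)
  also have "\<dots> = (\<Sum>i<8. \<Sum>j<8. ?F i * ?E j * connection_coeff p i e j)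
      - (\<Sum>i<8. \<Sum>j<8. ?E i * ?F j * connection_coeff p i e j)"
    by (simp add: connection_component[OF E F e orth(2)] connection_component[OF F E e orth(1)])
  also have "(\<Sum>i<8. \<Sum>j<8. ?F i * ?E j * connection_coeff p i e j) =
      (\<Sum>i<8. \<Sum>j<8. ?E i * ?F j * connection_coeff p j e i)"
    by (subst sum.swap) (simp add: mult_ac)
  also have "\<dots> - (\<Sum>i<8. \<Sum>j<8. ?E i * ?F j * connection_coeff p i e j) =
      (\<Sum>i<8. \<Sum>j<8. ?E i * ?F j * (connection_coeff p j e i - connection_coeff p i e j))"
    by (simp add: sum_subtractf right_diff_distrib)
  also have "\<dots> = (\<Sum>i<8. \<Sum>j<8. ?E i * ?F j * struct_const i j e)"
  proof (intro sum.cong refl)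
    fix i j :: nat assume "i \<in> {..<8}" "j \<in> {..<8}"
    then have ij: "i < 8" "j < 8" by auto
    show "?E i * ?F j * (connection_coeff p j e i - connection_coeff p i e j) = ?E i * ?F j * struct_const i j e"
      using connection_coeff_torsion[OF ij e, of p] connection_coeff_skew[OF ij(1) ij(2) e, of p]
        connection_coeff_skew[OF ij(2) ij(1) e, of p] by simp
  qed
  finally show ?thesis .
qed

end

section \<open>Vertical and horizontal distributions of the adapted frame\<close>

locale su2_su2_frame = left_invariant_frame G \<A> g D X
  for G :: "'g::{t2_space, second_countable_topology} monoid"
    and \<A> :: "('g, 'e::euclidean_space) chart set" and g D X +
  assumes orthonormal: "\<lbrakk>i < 6; j < 8\<rbrakk> \<Longrightarrow> g p (X i p) (X j p) = (if i = j then 1 else 0)"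
    and bracket_su2_su2: "\<lbrakk>i < 6; j < 6\<rbrakk> \<Longrightarrow>
      lie_bracket \<A> (X i) (X j) = (\<lambda>p f. \<Sum>m<6. su2_su2_const i j m * X m p f)"
begin

sublocale su2_su2_codim2 struct_const
proof
  fix i j k :: nat assume ijk: "i < 6" "j < 6" "k < 8"
  have "struct_const i j k = g \<one>\<^bsub>G\<^esub> (lie_bracket \<A> (X i) (X j) \<one>\<^bsub>G\<^esub>) (X k \<one>\<^bsub>G\<^esub>)"
    using ijk by (simp add: struct_const)
  also have "\<dots> = (\<Sum>m<6. su2_su2_const i j m * g \<one>\<^bsub>G\<^esub> (X m \<one>\<^bsub>G\<^esub>) (X k \<one>\<^bsub>G\<^esub>))"
    unfolding bracket_su2_su2[OF ijk(1,2)] by (rule metric_sum) (use ijk in \<open>auto intro: X_tangent\<close>)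
  also have "\<dots> = (\<Sum>m<6. if m = k then su2_su2_const i j m else 0)"
    using ijk by (intro sum.cong refl) (simp add: orthonormal)
  \<comment> \<open>For \<open>k\<close> equal to 6 or 7 no index \<open>m\<close> matches and the
    sum is 0, as is the constant.\<close>
  also have "\<dots> = su2_su2_const i j k"
    by (simp add: su2_su2_const_def)
  finally show "struct_const i j k = su2_su2_const i j k" .
qed (auto simp: struct_const_Jacobi intro: struct_const_antisym)

text \<open>Described by vanishing components, like \<open>H\<close> below, so that membership of a
  section becomes a condition on its inner products with the frame; \<open>V_eq_span\<close> gives
  the link to the generated distribution.\<close>

definition V :: "'g distribution" where
  "V p = {v \<in> tangent_space \<A> p. \<forall>e. 6 \<le> e \<and> e < 8 \<longrightarrow> g p v (X e p) = 0}"

definition H :: "'g distribution" where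
  "H p = {v \<in> tangent_space \<A> p. \<forall>e<6. g p v (X e p) = 0}"

lemma V_eq_span: "V p = {(\<lambda>f. \<Sum>i<6. c i * X i p f) | c. True}"
proof (intro equalityI subsetI)
  fix v assume v: "v \<in> V p"
  then have "v = (\<lambda>f. \<Sum>i<8. g p v (X i p) * X i p f)"
    by (intro Parseval) (simp add: V_def)
  also have "\<dots> = (\<lambda>f. \<Sum>i<6. g p v (X i p) * X i p f)"
    using v by (intro ext sum.mono_neutral_right) (auto simp: V_def)
  finally have eq: "v = (\<lambda>f. \<Sum>i<6. g p v (X i p) * X i p f)" .
  show "v \<in> {(\<lambda>f. \<Sum>i<6. c i * X i p f) | c. True}"
    by (rule CollectI, rule exI, rule conjI, rule eq, rule TrueI)
next
  fix v assume "v \<in> {(\<lambda>f. \<Sum>i<6. c i * X i p f) | c. True}"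
  then obtain c where v: "v = (\<lambda>f. \<Sum>i<6. c i * X i p f)" by blast
  have T: "X i p \<in> tangent_space \<A> p" if "i < 6" for i
    using that by (intro X_tangent) simp
  have "g p v (X e p) = 0" if "6 \<le> e" "e < 8" for e
  proof -
    have "g p v (X e p) = (\<Sum>i<6. c i * g p (X i p) (X e p))"
      unfolding v by (rule metric_sum[OF T X_tangent[OF that(2)]])
    also have "\<dots> = 0" using that by (intro sum.neutral) (simp add: orthonormal)
    finally show ?thesis .
  qed
  moreover have "v \<in> tangent_space \<A> p" unfolding v by (rule tangent_vector_sum[OF T])
  ultimately show "v \<in> V p" by (simp add: V_def)
qed

lemma metric_eq_zero_componentwise:
  assumes "v \<in> tangent_space \<A> p" "u \<in> tangent_space \<A> p"
    and "\<And>i. i < 8 \<Longrightarrow> g p v (X i p) = 0 \<or> g p u (X i p) = 0"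
  shows "g p v u = 0"
  unfolding metric_Parseval[OF assms(1,2)] using assms(3) by (intro sum.neutral) auto

lemma orth_complement_V: "orth_complement \<A> g V = H"
proof (intro ext equalityI subsetI)
  fix p v assume v: "v \<in> orth_complement \<A> g V p"
  have "X e p \<in> V p" if "e < 6" for e
    using that X_tangent[of e p] by (auto simp: V_def orthonormal)
  with v show "v \<in> H p" by (auto simp: orth_complement_def H_def)
next
  fix p v assume v: "v \<in> H p"
  have "g p v u = 0" if u: "u \<in> V p" for u
  proof (rule metric_eq_zero_componentwise)
    show "g p v (X i p) = 0 \<or> g p u (X i p) = 0" if "i < 8" for i
      using u v that by (cases "i < 6") (simp_all add: V_def H_def)
  qed (use u v in \<open>simp_all add: V_def H_def\<close>)
  with v show "v \<in> orth_complement \<A> g V p" by (simp add: orth_complement_def H_def)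
qed

lemma sections_V: "E \<in> sections \<A> V \<longleftrightarrow> smooth_vector_field \<A> E \<and>
    (\<forall>p e. 6 \<le> e \<and> e < 8 \<longrightarrow> g p (E p) (X e p) = 0)"
  by (auto simp: sections_def V_def dest: vector_field_tangent)

lemma sections_H: "E \<in> sections \<A> H \<longleftrightarrow> smooth_vector_field \<A> E \<and>
    (\<forall>p e. e < 6 \<longrightarrow> g p (E p) (X e p) = 0)"
  by (auto simp: sections_def H_def dest: vector_field_tangent)

lemma sym_connection_tangent:
  assumes "smooth_vector_field \<A> E" "smooth_vector_field \<A> F"
  shows "(\<lambda>f. D E F p f + D F E p f) \<in> tangent_space \<A> p"
  using tangent_lincomb[OF connection_tangent[OF assms] connection_tangent[OF assms(2,1)], where a = 1 and b = 1] by simp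

lemma sections_V_bracket:
  assumes "E \<in> sections \<A> V" "F \<in> sections \<A> V"
  shows "lie_bracket \<A> E F \<in> sections \<A> V"
proof -
  have E: "smooth_vector_field \<A> E" and F: "smooth_vector_field \<A> F"
    using assms by (auto simp: sections_V)
  have "g p (lie_bracket \<A> E F p) (X e p) = 0" if e: "6 \<le> e" "e < 8" for p e
  proof -
    have "g p (lie_bracket \<A> E F p) (X e p) =
        (\<Sum>i<8. \<Sum>j<8. g p (E p) (X i p) * g p (F p) (X j p) * struct_const i j e)"
      using assms e by (intro bracket_component[OF E F]) (auto simp: sections_V)
    also have "\<dots> = 0"
    proof (intro sum.neutral ballI)
      fix i j :: nat assume ij: "i \<in> {..<8}" "j \<in> {..<8}"
      show "g p (E p) (X i p) * g p (F p) (X j p) * struct_const i j e = 0"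
      proof (cases "i < 6 \<and> j < 6")
        case True
        then show ?thesis using e by (simp add: subalgebra su2_su2_const_outside)
      next
        case False
        then show ?thesis using assms ij by (auto simp: sections_V not_less)
      qed
    qed
    finally show ?thesis .
  qed
  then show ?thesis using lie_bracket_smooth[OF E F] by (simp add: sections_V)
qed

lemma foliation_V: "foliation \<A> 6 V"
  unfolding foliation_def smooth_distribution_def
proof (intro conjI ballI allI sections_V_bracket)
  fix p
  \<comment> \<open>The frame is global, so all of \<open>UNIV\<close> serves as the neighbourhood
    of every point.\<close>
  let ?Xs = "map X [0..<6]"
  have "V q = (\<lambda>X. X q) ` vf_span ?Xs" for q
  proof -
    have "(\<lambda>X. X q) ` vf_span ?Xs = {(\<lambda>f. \<Sum>i<6. c i * X i q f) | c. True}"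
      unfolding vf_span_def by (auto intro!: image_eqI)
    then show ?thesis using V_eq_span by simp
  qed
  moreover have "c i = 0"
    if c: "(\<lambda>f. \<Sum>i<6. c i * (?Xs ! i) q f) = (\<lambda>f. 0)" and i: "i < 6" for q i and c :: "nat \<Rightarrow> real"
  proof -
    have T: "X j q \<in> tangent_space \<A> q" if "j < 6" for j
      using that by (intro X_tangent) simp
    have "(\<lambda>f. \<Sum>j<6. c j * X j q f) = (\<lambda>f. 0)"
      using c by simp
    then have "0 = g q (\<lambda>f. \<Sum>j<6. c j * X j q f) (X i q)"
      using metric_zero[OF T[OF i]] by simp
    also have "\<dots> = (\<Sum>j<6. c j * g q (X j q) (X i q))"
      by (rule metric_sum[OF T T[OF i]])
    also have "\<dots> = (\<Sum>j<6. if j = i then c j else 0)"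
      using i by (intro sum.cong refl) (simp add: orthonormal)
    also have "\<dots> = c i" using i by simp
    finally show ?thesis by simp
  qed
  moreover have "\<forall>Y\<in>set ?Xs. smooth_vector_field \<A> Y"
    by (auto intro: X_smooth)
  ultimately show "\<exists>W Xs. open W \<and> p \<in> W \<and> length Xs = 6 \<and> (\<forall>X\<in>set Xs. smooth_vector_field \<A> X) \<and>
        (\<forall>q\<in>W. V q = (\<lambda>X. X q) ` vf_span Xs \<and>
           (\<forall>c::nat \<Rightarrow> real. (\<lambda>f. \<Sum>i<6. c i * (Xs ! i) q f) = (\<lambda>f. 0) \<longrightarrow> (\<forall>i<6. c i = 0)))"
    by (intro exI[of _ UNIV] exI[of _ ?Xs]) (simp del: upt.simps upt_rec_numeral)
qed

text \<open>Here \<open>e\<close> lies in \<kk> and only transversal \<open>i\<close>,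
  \<open>j\<close> contribute, so the vanishing rests on the trivial action of \<kk> on
  \<gg>/\<kk>.\<close>

lemma riemannian_foliation_V: "riemannian_foliation \<A> g D V"
  unfolding riemannian_foliation_def orth_complement_V
proof (intro ballI)
  fix E F assume "E \<in> sections \<A> H" "F \<in> sections \<A> H"
  then have E: "smooth_vector_field \<A> E" "\<And>p e. e < 6 \<Longrightarrow> g p (E p) (X e p) = 0"
    and F: "smooth_vector_field \<A> F" "\<And>p e. e < 6 \<Longrightarrow> g p (F p) (X e p) = 0"
    by (auto simp: sections_H)
  have comp: "g p (\<lambda>f. D E F p f + D F E p f) (X e p) = 0" if e: "e < 6" for p e
  proof (rule connection_sym_component[OF E(1) F(1)])
    fix i j :: nat
    assume "i < 8" "j < 8" "g p (E p) (X i p) \<noteq> 0" "g p (F p) (X j p) \<noteq> 0"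
    then show "struct_const i e j + struct_const j e i = 0"
      using E(2)[of i p] F(2)[of j p] e by (intro skew_transversal) auto
  qed (use e E(2) F(2) in auto)
  have "orth_projection g V (\<lambda>q h. D E F q h + D F E q h) p = (\<lambda>f. 0)" for p
  proof (rule orth_projection_eq_zero)
    show "V p \<subseteq> tangent_space \<A> p" by (auto simp: V_def)
    show "(\<lambda>f. 0) \<in> V p" by (auto simp: V_def tangent_zero metric_zero X_tangent)
    show "(\<lambda>f. D E F p f + D F E p f) \<in> tangent_space \<A> p"
      by (rule sym_connection_tangent[OF E(1) F(1)])
    fix u assume u: "u \<in> V p"
    show "g p (\<lambda>f. D E F p f + D F E p f) u = 0"
    proof (rule metric_eq_zero_componentwise[OF sym_connection_tangent[OF E(1) F(1)]])
      show "g p (\<lambda>f. D E F p f + D F E p f) (X i p) = 0 \<or> g p u (X i p) = 0" if "i < 8" for i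
        using u comp[of i p] that by (cases "i < 6") (simp_all add: V_def)
    qed (use u in \<open>simp add: V_def\<close>)
  qed
  then show "horizontal_second_fundamental_form g D V E F = (\<lambda>p f. 0)"
    by (simp add: horizontal_second_fundamental_form_def)
qed

text \<open>The roles are exchanged: \<open>e\<close> is transversal and \<open>i\<close>,
  \<open>j\<close> lie in \<kk>, so the vanishing rests on the skewness of the derivation induced by
  \<open>X e\<close>.\<close>

lemma totally_geodesic_V: "totally_geodesic \<A> g D V"
  unfolding totally_geodesic_def
proof (intro ballI)
  fix E F assume "E \<in> sections \<A> V" "F \<in> sections \<A> V"
  then have E: "smooth_vector_field \<A> E" "\<And>p e. 6 \<le> e \<Longrightarrow> e < 8 \<Longrightarrow> g p (E p) (X e p) = 0"
    and F: "smooth_vector_field \<A> F" "\<And>p e. 6 \<le> e \<Longrightarrow> e < 8 \<Longrightarrow> g p (F p) (X e p) = 0"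
    by (auto simp: sections_V)
  have comp: "g p (\<lambda>f. D E F p f + D F E p f) (X e p) = 0" if e: "6 \<le> e" "e < 8" for p e
  proof (rule connection_sym_component[OF E(1) F(1) e(2)])
    fix i j :: nat
    assume ij: "i < 8" "j < 8" "g p (E p) (X i p) \<noteq> 0" "g p (F p) (X j p) \<noteq> 0"
    have "i < 6" "j < 6"
      using E(2)[of i p] F(2)[of j p] ij by (meson not_less)+
    then show "struct_const i e j + struct_const j e i = 0"
      using ij e by (intro skew_transversal) auto
  qed (use e E(2) F(2) in auto)
  have "orth_projection g H (\<lambda>q h. D E F q h + D F E q h) p = (\<lambda>f. 0)" for p
  proof (rule orth_projection_eq_zero)
    show "H p \<subseteq> tangent_space \<A> p" by (auto simp: H_def)
    show "(\<lambda>f. 0) \<in> H p" by (auto simp: H_def tangent_zero metric_zero X_tangent)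
    show "(\<lambda>f. D E F p f + D F E p f) \<in> tangent_space \<A> p"
      by (rule sym_connection_tangent[OF E(1) F(1)])
    fix u assume u: "u \<in> H p"
    show "g p (\<lambda>f. D E F p f + D F E p f) u = 0"
    proof (rule metric_eq_zero_componentwise[OF sym_connection_tangent[OF E(1) F(1)]])
      show "g p (\<lambda>f. D E F p f + D F E p f) (X i p) = 0 \<or> g p u (X i p) = 0" if "i < 8" for i
        using u comp[of i p] that by (cases "i < 6") (simp_all add: H_def)
    qed (use u in \<open>simp add: H_def\<close>)
  qed
  then show "second_fundamental_form \<A> g D V E F = (\<lambda>p f. 0)"
    by (simp add: second_fundamental_form_def orth_complement_V)
qed

end

section \<open>Completion to a left-invariant frame\<close>

context riemannian_manifold
begin

lemma orthonormal_extend: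
  assumes "\<And>i. i < n \<Longrightarrow> u i \<in> tangent_space \<A> p" "w \<in> tangent_space \<A> p"
    and "\<And>i j. i < n \<Longrightarrow> j < n \<Longrightarrow> g p (u i) (u j) = (if i = j then 1 else 0)"
    and "\<And>i. i < n \<Longrightarrow> g p w (u i) = 0" "g p w w = 1"
    and "i < Suc n" "j < Suc n"
  shows "g p ((u(n := w)) i) ((u(n := w)) j) = (if i = j then 1 else 0)"
proof -
  have "g p (u i) w = 0" if "i < n" for i
    using metric_sym[OF assms(1)[OF that] assms(2)] assms(4)[OF that] by simp
  then show ?thesis
    using assms(3-7) by (auto simp: less_Suc_eq)
qed

end

text \<open>All choices are made in the tangent space at the identity; left translation spreads them
  over the group and preserves inner products.\<close>

lemma (in left_invariant_geometry) frame_completion: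
  fixes Y :: "nat \<Rightarrow> 'g vfield"
  assumes dim: "DIM('e) = 8"
    and Y: "\<And>i. i < 6 \<Longrightarrow> Y i \<in> left_invariant_fields G \<A>"
    and on: "\<And>i j. i < 6 \<Longrightarrow> j < 6 \<Longrightarrow> g \<one>\<^bsub>G\<^esub> (Y i \<one>\<^bsub>G\<^esub>) (Y j \<one>\<^bsub>G\<^esub>) = (if i = j then 1 else 0)"
  shows "\<exists>X. (\<forall>i<6. X i = Y i) \<and> left_invariant_frame G \<A> g D X \<and>
    (\<forall>p. \<forall>i<6. \<forall>j<8. g p (X i p) (X j p) = (if i = j then 1 else 0))"
proof -
  let ?e = "\<one>\<^bsub>G\<^esub>"
  let ?T = "tangent_space \<A> ?e"
  define u0 where "u0 i = Y i ?e" for i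
  have T0: "u0 i \<in> ?T" if "i < 6" for i
    unfolding u0_def by (rule vector_field_tangent[OF left_invariantD(1)[OF Y[OF that]]])
  have on0: "g ?e (u0 i) (u0 j) = (if i = j then 1 else 0)" if "i < 6" "j < 6" for i j
    unfolding u0_def by (rule on[OF that])
  obtain w6 where w6: "w6 \<in> ?T" "\<And>i. i < 6 \<Longrightarrow> g ?e w6 (u0 i) = 0"
    "\<And>v. g ?e w6 w6 \<noteq> 1 \<Longrightarrow> v \<in> ?T \<Longrightarrow> (\<And>i. i < 6 \<Longrightarrow> g ?e v (u0 i) = 0) \<Longrightarrow> v = (\<lambda>f. 0)"
    "g ?e w6 w6 \<noteq> 1 \<Longrightarrow> w6 = (\<lambda>f. 0)"
    using extend_orthonormal[of 6 u0 ?e, OF T0] by blast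
  define u1 where "u1 = u0(6 := w6)"
  have T1: "u1 i \<in> ?T" if "i < 7" for i
    using that T0[of i] w6(1) by (cases "i = 6") (simp_all add: u1_def)
  obtain w7 where w7: "w7 \<in> ?T" "\<And>i. i < 7 \<Longrightarrow> g ?e w7 (u1 i) = 0"
    "\<And>v. g ?e w7 w7 \<noteq> 1 \<Longrightarrow> v \<in> ?T \<Longrightarrow> (\<And>i. i < 7 \<Longrightarrow> g ?e v (u1 i) = 0) \<Longrightarrow> v = (\<lambda>f. 0)"
    "g ?e w7 w7 \<noteq> 1 \<Longrightarrow> w7 = (\<lambda>f. 0)"
    using extend_orthonormal[of 7 u1 ?e, OF T1] by blast
  define u2 where "u2 = u1(7 := w7)"
  have T2: "u2 i \<in> ?T" if "i < 8" for i
    using that T1[of i] w7(1) by (cases "i = 7") (simp_all add: u2_def)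
  have u2: "u2 i = u0 i" if "i < 6" for i
    using that by (simp add: u2_def u1_def)
  have u2_6: "u2 6 = w6" and u2_7: "u2 7 = w7"
    by (simp_all add: u2_def u1_def)
  \<comment> \<open>A nonzero \<open>v\<close> orthogonal to all eight vectors shows that neither
    extension step had run out of room, so both added vectors are unit vectors. A ninth one can then
    be added, and nine orthonormal vectors exceed \<open>DIM('e) = 8\<close>.\<close>
  have complete: "v = (\<lambda>f. 0)" if v: "v \<in> ?T" "\<And>i. i < 8 \<Longrightarrow> g ?e v (u2 i) = 0" for v
  proof (rule ccontr)
    assume ne: "v \<noteq> (\<lambda>f. 0)"
    have v0: "g ?e v (u0 i) = 0" if "i < 6" for i
      using v(2)[of i] u2[OF that] that by simp
    have v1: "g ?e v (u1 i) = 0" if "i < 7" for i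
      using v(2)[of i] that by (simp add: u2_def)
    have "g ?e w6 w6 = 1" using w6(3)[OF _ v(1) v0] ne by blast
    from orthonormal_extend[OF T0 w6(1) on0 w6(2) this]
    have on1: "g ?e (u1 i) (u1 j) = (if i = j then 1 else 0)" if "i < 7" "j < 7" for i j
      using that by (simp add: u1_def)
    have "g ?e w7 w7 = 1" using w7(3)[OF _ v(1) v1] ne by blast
    from orthonormal_extend[OF T1 w7(1) on1 w7(2) this]
    have on2: "g ?e (u2 i) (u2 j) = (if i = j then 1 else 0)" if "i < 8" "j < 8" for i j
      using that by (simp add: u2_def)
    obtain w8 where w8: "w8 \<in> ?T" "\<And>i. i < 8 \<Longrightarrow> g ?e w8 (u2 i) = 0"
      "\<And>v. g ?e w8 w8 \<noteq> 1 \<Longrightarrow> v \<in> ?T \<Longrightarrow> (\<And>i. i < 8 \<Longrightarrow> g ?e v (u2 i) = 0) \<Longrightarrow> v = (\<lambda>f. 0)"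
      "g ?e w8 w8 \<noteq> 1 \<Longrightarrow> w8 = (\<lambda>f. 0)"
      using extend_orthonormal[of 8 u2 ?e, OF T2] by blast
    have "g ?e w8 w8 = 1" using w8(3)[OF _ v] ne by blast
    from orthonormal_extend[OF T2 w8(1) on2 w8(2) this]
    have "g ?e ((u2(8 := w8)) i) ((u2(8 := w8)) j) = (if i = j then 1 else 0)" if "i < 9" "j < 9" for i j
      using that by simp
    moreover have "(u2(8 := w8)) i \<in> ?T" if "i < 9" for i
      using that T2[of i] w8(1) by (cases "i = 8") simp_all
    ultimately have "9 \<le> DIM('e)"
      by (intro orthonormal_length_le_DIM[of 9 "u2(8 := w8)" ?e])
    then show False using dim by simp
  qed
  have orth_less: "g ?e (u2 j) (u2 i) = 0" if "i < j" "j < 8" for i j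
  proof -
    have "j < 6 \<or> j = 6 \<or> j = 7" using that(2) by arith
    then consider "j < 6" | "j = 6" | "j = 7" by blast
    then show ?thesis
    proof cases
      case 1
      then show ?thesis using that on0[of j i] by (simp add: u2)
    next
      case 2
      then show ?thesis using that w6(2)[of i] by (simp add: u2 u2_6)
    next
      case 3
      then have "u2 i = u1 i" using that by (simp add: u2_def)
      then show ?thesis using 3 that w7(2)[of i] by (simp add: u2_7)
    qed
  qed
  have orth: "g ?e (u2 i) (u2 j) = 0" if "i < 8" "j < 8" "i \<noteq> j" for i j
    using orth_less[of i j] orth_less[of j i] metric_sym[OF T2[OF that(1)] T2[OF that(2)]] that
    by (cases "i < j") auto
  \<comment> \<open>As \<open>u2 6\<close> and \<open>u2 7\<close> are known only to be unit or
    zero, normalisation is stated in this multiplied form, in which the zero case reads 0 =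
    0.\<close>
  have unit: "g ?e v (u2 i) * g ?e (u2 i) (u2 i) = g ?e v (u2 i)" if v: "v \<in> ?T" and i: "i < 8" for v i
  proof -
    have "i < 6 \<or> i = 6 \<or> i = 7" using i by arith
    then have "g ?e (u2 i) (u2 i) = 1 \<or> u2 i = (\<lambda>f. 0)"
      using on0[of i i] w6(4) w7(4) by (elim disjE) (auto simp: u2 u2_6 u2_7)
    then show ?thesis
      using metric_sym[OF v T2[OF i]] metric_zero[OF v] by auto
  qed
  have expand: "v = (\<lambda>f. \<Sum>i<8. g ?e v (u2 i) * u2 i f)" if v: "v \<in> ?T" for v
  proof -
    let ?s = "\<lambda>f. \<Sum>i<8. g ?e v (u2 i) * u2 i f"
    have s: "?s \<in> ?T" by (rule tangent_vector_sum[OF T2])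
    have "(\<lambda>f. v f - ?s f) = (\<lambda>f. 0)"
    proof (rule complete[OF tangent_vector_diff[OF v s]])
      fix j :: nat assume j: "j < 8"
      have "g ?e ?s (u2 j) = (\<Sum>i<8. g ?e v (u2 i) * g ?e (u2 i) (u2 j))"
        by (rule metric_sum[OF T2 T2[OF j]])
      also have "\<dots> = (\<Sum>i<8. if i = j then g ?e v (u2 i) else 0)"
        using j by (intro sum.cong refl) (simp add: orth unit[OF v])
      finally show "g ?e (\<lambda>f. v f - ?s f) (u2 j) = 0"
        using metric_diff[OF v s T2[OF j]] j by simp
    qed
    then show ?thesis by (simp add: fun_eq_iff)
  qed
  define X where "X i p = push_left G p (u2 i)" for i p
  have metric_X: "g p (push_left G p v) (X i p) = g ?e v (u2 i)" if "v \<in> ?T" "i < 8" for p v i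
    using metric_push_left[OF that(1) T2[OF that(2)], of p] by (simp add: X_def)
  show ?thesis
  proof (intro exI[of _ X] conjI allI impI)
    show "X i = Y i" if "i < 6" for i
    proof
      fix p
      have "X i p = push_left G p (Y i ?e)" by (simp add: X_def u2[OF that] u0_def)
      also have "\<dots> = Y i p" by (rule left_invariantD(3)[OF Y[OF that], symmetric])
      finally show "X i p = Y i p" .
    qed
    show "g p (X i p) (X j p) = (if i = j then 1 else 0)" if "i < 6" "j < 8" for i j p
    proof -
      have "g p (X i p) (X j p) = g ?e (u2 i) (u2 j)"
        using metric_X[OF T2[of i] that(2), of p] that by (simp add: X_def)
      then show ?thesis using orth[of i j] on0[of i i] that by (auto simp: u2)
    qed
    show "left_invariant_frame G \<A> g D X"
    proof unfold_locales
      show "X i \<in> left_invariant_fields G \<A>" if "i < 8" for i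
        using left_invariant_extension[OF T2[OF that]] by (simp add: X_def[abs_def])
      fix v p assume v: "v \<in> tangent_space \<A> p"
      \<comment> \<open>The vector is moved to the identity, expanded there and pushed back;
        invariance of the metric identifies the coefficients with those at \<open>p\<close>.\<close>
      define v' where "v' = push_left G (inv\<^bsub>G\<^esub> p) v"
      have v': "v' \<in> ?T"
        using push_left_tangent[OF v, of "inv\<^bsub>G\<^esub> p"] by (simp add: v'_def)
      have vv': "v = push_left G p v'"
        by (simp add: v'_def push_left_push_left push_left_one)
      have "push_left G p v' = push_left G p (\<lambda>f. \<Sum>i<8. g ?e v' (u2 i) * u2 i f)"
        by (rule arg_cong[OF expand[OF v']])
      also have "\<dots> = (\<lambda>f. \<Sum>i<8. g ?e v' (u2 i) * X i p f)"
        by (simp add: push_left_def X_def)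
      also have "\<dots> = (\<lambda>f. \<Sum>i<8. g p v (X i p) * X i p f)"
        unfolding vv' using metric_X[OF v'] by simp
      finally show "v = (\<lambda>f. \<Sum>i<8. g p v (X i p) * X i p f)"
        using vv' by simp
    qed
  qed
qed

section \<open>From the standard metric to the adapted frame\<close>

lemma su2_su2_bracket_table:
  assumes ABC: "su2_relations \<A> A B C" and RST: "su2_relations \<A> R S T"
    and comm: "\<forall>X\<in>{A, B, C}. \<forall>Y\<in>{R, S, T}. lie_bracket \<A> X Y = (\<lambda>p f. 0)"
    and "i < 6" "j < 6"
  shows "lie_bracket \<A> ([A, B, C, R, S, T] ! i) ([A, B, C, R, S, T] ! j) =
    (\<lambda>p f. \<Sum>m<6. su2_su2_const i j m * ([A, B, C, R, S, T] ! m) p f)"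
proof -
  have sum_6: "(\<Sum>m<6. h m) = h 0 + h 1 + h 2 + h 3 + h 4 + h 5" for h :: "nat \<Rightarrow> real"
    by (simp add: eval_nat_numeral)
  have antisym: "lie_bracket \<A> Y X = (\<lambda>p f. - lie_bracket \<A> X Y p f)" for X Y
    by (simp add: lie_bracket_def fun_eq_iff)
  have self: "lie_bracket \<A> X X = (\<lambda>p f. 0)" for X
    by (simp add: lie_bracket_def fun_eq_iff)
  have pos: "lie_bracket \<A> A B = (\<lambda>p f. 2 * C p f)" "lie_bracket \<A> C A = (\<lambda>p f. 2 * B p f)"
    "lie_bracket \<A> B C = (\<lambda>p f. 2 * A p f)" "lie_bracket \<A> R S = (\<lambda>p f. 2 * T p f)"
    "lie_bracket \<A> T R = (\<lambda>p f. 2 * S p f)" "lie_bracket \<A> S T = (\<lambda>p f. 2 * R p f)"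
    using ABC RST by (simp_all add: su2_relations_def)
  have neg: "lie_bracket \<A> B A = (\<lambda>p f. - 2 * C p f)" "lie_bracket \<A> A C = (\<lambda>p f. - 2 * B p f)"
    "lie_bracket \<A> C B = (\<lambda>p f. - 2 * A p f)" "lie_bracket \<A> S R = (\<lambda>p f. - 2 * T p f)"
    "lie_bracket \<A> R T = (\<lambda>p f. - 2 * S p f)" "lie_bracket \<A> T S = (\<lambda>p f. - 2 * R p f)"
    using antisym[of B A] antisym[of A C] antisym[of C B] antisym[of S R] antisym[of R T] antisym[of T S]
    by (simp_all add: pos)
  have zero: "lie_bracket \<A> X Y = (\<lambda>p f. 0)" "lie_bracket \<A> Y X = (\<lambda>p f. 0)"
    if "X \<in> {A, B, C}" "Y \<in> {R, S, T}" for X Y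
    using comm that antisym[of Y X] by auto
  have zeros: "lie_bracket \<A> A R = (\<lambda>p f. 0)" "lie_bracket \<A> A S = (\<lambda>p f. 0)" "lie_bracket \<A> A T = (\<lambda>p f. 0)"
    "lie_bracket \<A> B R = (\<lambda>p f. 0)" "lie_bracket \<A> B S = (\<lambda>p f. 0)" "lie_bracket \<A> B T = (\<lambda>p f. 0)"
    "lie_bracket \<A> C R = (\<lambda>p f. 0)" "lie_bracket \<A> C S = (\<lambda>p f. 0)" "lie_bracket \<A> C T = (\<lambda>p f. 0)"
    "lie_bracket \<A> R A = (\<lambda>p f. 0)" "lie_bracket \<A> S A = (\<lambda>p f. 0)" "lie_bracket \<A> T A = (\<lambda>p f. 0)"
    "lie_bracket \<A> R B = (\<lambda>p f. 0)" "lie_bracket \<A> S B = (\<lambda>p f. 0)" "lie_bracket \<A> T B = (\<lambda>p f. 0)"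
    "lie_bracket \<A> R C = (\<lambda>p f. 0)" "lie_bracket \<A> S C = (\<lambda>p f. 0)" "lie_bracket \<A> T C = (\<lambda>p f. 0)"
    by (rule zero; simp)+
  have "i = 0 \<or> i = 1 \<or> i = 2 \<or> i = 3 \<or> i = 4 \<or> i = 5"
    "j = 0 \<or> j = 1 \<or> j = 2 \<or> j = 3 \<or> j = 4 \<or> j = 5"
    using assms(4,5) by arith+
  then show ?thesis
    unfolding sum_6
    by (elim disjE; simp add: su2_su2_const_def self pos neg zeros)
qed

lemma nth_in_vf_span:
  assumes "i < length Xs"
  shows "Xs ! i \<in> vf_span Xs"
proof -
  have eq: "Xs ! i = (\<lambda>p f. \<Sum>k<length Xs. (if k = i then 1 else 0) * (Xs ! k) p f)"
  proof (intro ext)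
    fix p f
    have "(\<Sum>k<length Xs. (if k = i then 1 else 0) * (Xs ! k) p f) =
        (\<Sum>k<length Xs. if k = i then (Xs ! k) p f else 0)"
      by (intro sum.cong refl) simp
    then show "(Xs ! i) p f = (\<Sum>k<length Xs. (if k = i then 1 else 0) * (Xs ! k) p f)"
      using assms by simp
  qed
  show ?thesis
    unfolding vf_span_def by (rule CollectI, rule exI, rule conjI, rule eq, rule TrueI)
qed

theorem theorem4p2:
  fixes G :: "'g::{t2_space, second_countable_topology} monoid"
    and \<A> :: "('g, 'e::euclidean_space) chart set"
    and g :: "'g metric"
    and \<iota> :: "(complex^2^2) \<times> (complex^2^2) \<Rightarrow> 'g"
    and D :: "'g vfield \<Rightarrow> 'g vfield \<Rightarrow> 'g vfield"
    and V :: "'g distribution"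
  assumes "lie_group G \<A>"
    and "DIM('e) = 8"
    and "riemannian_metric \<A> g"
    and "left_invariant_metric G \<A> g"
    and "SU2xSU2_embedding G \<A> \<iota>"
    and "standard_on_SU2xSU2 G \<A> g \<iota>"
    and "levi_civita \<A> g D"
    and "V = generated_distribution (subgroup_lie_algebra G \<A> (\<iota> ` carrier (SU2 \<times>\<times> SU2)))"
  shows "foliation \<A> 6 V \<and> riemannian_foliation \<A> g D V \<and> totally_geodesic \<A> g D V"
proof -
  interpret lie_group_manifold G \<A>
    by unfold_locales (rule assms(1))
  interpret left_invariant_geometry G \<A> g D
    by unfold_locales (rule assms(3) assms(4) assms(7))+
  let ?K = "subgroup_lie_algebra G \<A> (\<iota> ` carrier (SU2 \<times>\<times> SU2))"
  obtain A B C R S T where span: "vf_span [A, B, C, R, S, T] = ?K"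
    and on: "orthonormal_frame g [A, B, C, R, S, T]"
    and rel: "su2_relations \<A> A B C" "su2_relations \<A> R S T"
      "\<forall>X\<in>{A, B, C}. \<forall>Y\<in>{R, S, T}. lie_bracket \<A> X Y = (\<lambda>p f. 0)"
    using assms(6) unfolding standard_on_SU2xSU2_def by blast
  define L where "L = [A, B, C, R, S, T]"
  have len: "length L = 6" by (simp add: L_def)
  \<comment> \<open>The basis fields lie in the Lie algebra of the subgroup, whose members are
    left-invariant by definition.\<close>
  have Y: "L ! i \<in> left_invariant_fields G \<A>" if "i < 6" for i
    using nth_in_vf_span[of i L] that span unfolding len L_def[symmetric] subgroup_lie_algebra_def by blast
  have onL: "g \<one>\<^bsub>G\<^esub> ((L ! i) \<one>\<^bsub>G\<^esub>) ((L ! j) \<one>\<^bsub>G\<^esub>) = (if i = j then 1 else 0)" if "i < 6" "j < 6" for i j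
    using on that unfolding orthonormal_frame_def L_def[symmetric] len by simp
  obtain X where XY: "\<And>i. i < 6 \<Longrightarrow> X i = L ! i" and frame: "left_invariant_frame G \<A> g D X"
    and onX: "\<And>i j p. i < 6 \<Longrightarrow> j < 8 \<Longrightarrow> g p (X i p) (X j p) = (if i = j then 1 else 0)"
    using frame_completion[of "\<lambda>i. L ! i", OF assms(2) Y onL] by blast
  interpret F: su2_su2_frame G \<A> g D X
  proof (rule su2_su2_frame.intro[OF frame], unfold_locales)
    show "lie_bracket \<A> (X i) (X j) = (\<lambda>p f. \<Sum>m<6. su2_su2_const i j m * X m p f)"
      if "i < 6" "j < 6" for i j
      using su2_su2_bracket_table[OF rel that, folded L_def] that by (simp add: XY)
  qed (rule onX)
  \<comment> \<open>The frame completion kept the six given fields, so the pointwise span of \<kk>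
    is the span of the first six frame vectors.\<close>
  have "V = F.V"
  proof
    fix p
    have "V p = (\<lambda>X. X p) ` vf_span L"
      by (simp add: assms(8) generated_distribution_def span L_def)
    also have "\<dots> = {(\<lambda>f. \<Sum>i<6. c i * X i p f) | c. True}"
    proof -
      have "(\<Sum>i<6. c i * X i p f) = (\<Sum>i<6. c i * (L ! i) p f)" for c f
        by (intro sum.cong refl) (simp add: XY)
      then show ?thesis unfolding vf_span_def len by (auto intro!: image_eqI)
    qed
    finally show "V p = F.V p" unfolding F.V_eq_span .
  qed
  then show ?thesis
    using F.foliation_V F.riemannian_foliation_V F.totally_geodesic_V by simp
qed

end
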